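(* Assume that (ii) $q$ is Lipschitz continuous in $(\mu,a)$ with a Lipschitz constant $L_q$, and (iii) $F,G$ are bounded by a constant $C_0$ and uniformly continuous in $(\mu,a)$ with a modulus of continuity function $\rho$. Let $t\in\mathbb T$, and let $\mu^N_{\vec x}\in\mathcal P_N(\mathbb S)$ (where $\vec x=\vec x^N\in\mathbb S^N_0$ depends on $N$) converge to $\mu\in\mathcal P_0(\mathbb S)$ as $N\to\infty$. Then $$\bigcap_{\varepsilon>0}\bigcup_{L\ge0}\limsup_{N\to\infty}\mathbb V^{N,\varepsilon,L}_{state}(t,\mu^N_{\vec x})\subset\mathbb V_{state}(t,\mu)\subset\bigcap_{\varepsilon>0}\liminf_{N\to\infty}\mathbb V^{N,\varepsilon,0}_{state}(t,\mu^N_{\vec x}).$$ In particular, since $\liminf_{N\to\infty}\mathbb V^{N,\varepsilon,0}_{state}(t,\mu^N_{\vec x})\subset\bigcup_{L\ge0}\limsup_{N\to\infty}\mathbb V^{N,\varepsilon,L}_{state}(t,\mu^N_{\vec x})$, both inclusions are actually equalities.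
   Context: For sets $E_N$: $\limsup_NE_N:=\bigcap_{n\ge1}\bigcup_{N\ge n}E_N$, $\liminf_NE_N:=\bigcup_{n\ge1}\bigcap_{N\ge n}E_N$. Mean field game. $\mathbb T=\{0,\dots,T\}$; $\mathbb S$ is a finite set with $|\mathbb S|=d$; $\mathcal P(\mathbb S)$ is the set of probability measures on $\mathbb S$ with $W_1(\mu,\nu):=\sum_{x\in\mathbb S}|\mu(x)-\nu(x)|$; $\mathcal P_0(\mathbb S)$ is the subset of measures with full support. $\mathbb A\subset\mathbb R^{d_0}$ is a measurable set. $q:\mathbb T\times\mathbb S\times\mathcal P(\mathbb S)\times\mathbb A\times\mathbb S\to(0,1)$ is a transition probability function: $\sum_{\tilde x}q(t,x,\mu,a;\tilde x)=1$. $F:\mathbb T\times\mathbb S\times\mathcal P(\mathbb S)\times\mathbb A\to\mathbb R$, $G:\mathbb S\times\mathcal P(\mathbb S)\to\mathbb R$ are measurable. $\mathbb L^0(\mathbb S;\mathbb R)$ is the set of functions $\mathbb S\to\mathbb R$. $X$ is the canonical process on $\mathbb S^{T+1}$; $\mathcal A_{state}$ is the set of maps $\alpha:\mathbb T\times\mathbb S\to\mathbb A$. For $(t,\mu,\alpha)$, $\mathbb P^{t,\mu,\alpha}$ is determined by $\mathbb P^{t,\mu,\alpha}\circ X_t^{-1}=\mu$, $\mathbb P^{t,\mu,\alpha}(X_{s+1}=\tilde x|X_s=x)=q(s,x,\mu^\alpha_s,\alpha(s,x);\tilde x)$, $\mu^\alpha_s:=\mathbb P^{t,\mu,\alpha}\circ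 X_s^{-1}$, $s\ge t$. For a flow $\{\mu_\cdot\}$, $\mathbb P^{\{\mu_\cdot\};t,x,\tilde\alpha}$ is determined by $X_t=x$ a.s. and $\mathbb P(X_{s+1}=\bar x|X_s=\tilde x)=q(s,\tilde x,\mu_s,\tilde\alpha(s,\tilde x);\bar x)$. Set $J(\{\mu_\cdot\};t,x,\tilde\alpha):=\mathbb E^{\mathbb P^{\{\mu_\cdot\};t,x,\tilde\alpha}}[G(X_T,\mu_T)+\sum_{r=t}^{T-1}F(r,X_r,\mu_r,\tilde\alpha(r,X_r))]$, $J(t,\mu,\alpha;x,\tilde\alpha):=J(\mu^\alpha;t,x,\tilde\alpha)$, $v(\{\mu_\cdot\};t,x):=\inf_{\tilde\alpha\in\mathcal A_{state}}J(\{\mu_\cdot\};t,x,\tilde\alpha)$. For $\mu\in\mathcal P_0(\mathbb S)$: $\mathcal M^\varepsilon_{state}(t,\mu)$ is the set of $\alpha^*\in\mathcal A_{state}$ with $J(t,\mu,\alpha^*;x,\alpha^* )\le v(\mu^{\alpha^*};t,x)+\varepsilon$ for all $x\in\mathbb S$; $\mathbb V^\varepsilon_{state}(t,\mu):=\{\varphi\in\mathbb L^0(\mathbb S;\mathbb R):\|\varphi-J(t,\mu,\alpha^*;\cdot,\alpha^* )\|_\infty\le\varepsilon\text{ for some }\alpha^*\in\mathcal M^\varepsilon_{state}(t,\mu)\}$; $\mathbb V_{state}(t,\mu):=\bigcap_{\varepsilon>0}\mathbb V^\varepsilon_{state}(t,\mu)$. $N$-player game with homogeneous equilibria. $\vec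 X=(X^1,\dots,X^N)$ is the canonical process on $(\mathbb S^{T+1})^N$; $\mu^N_{\vec x}:=\frac1N\sum_{i=1}^N\delta_{x_i}$, $\mu^N_s:=\mu^N_{\vec X_s}$; $\mathbb S^N_0:=\{\vec x\in\mathbb S^N:\mu^N_{\vec x}\in\mathcal P_0(\mathbb S)\}$, $\mathcal P_N(\mathbb S):=\{\mu^N_{\vec x}:\vec x\in\mathbb S^N_0\}$. For $L\ge0$, $\mathcal A^L_{state}$ is the set of $\alpha:\mathbb T\times\mathbb S\times\mathcal P(\mathbb S)\to\mathbb A$ with $|\alpha(t,x,\mu)-\alpha(t,x,\nu)|\le LW_1(\mu,\nu)$ for all $t,x,\mu,\nu$. For $\vec\alpha=(\alpha^1,\dots,\alpha^N)$ with $\alpha^i\in\bigcup_L\mathcal A^L_{state}$, $\mathbb P^{t,\vec x,\vec\alpha}$ is determined by $\vec X_t=\vec x$ a.s. and $\mathbb P^{t,\vec x,\vec\alpha}(\vec X_{s+1}=\vec x''|\vec X_s=\vec x')=\prod_{i=1}^Nq(s,x_i',\mu^N_{\vec x'},\alpha^i(s,x_i',\mu^N_{\vec x'});x_i'')$; $J_i(t,\vec x,\vec\alpha):=\mathbb E^{\mathbb P^{t,\vec x,\vec\alpha}}[G(X^i_T,\mu^N_T)+\sum_{s=t}^{T-1}F(s,X^i_s,\mu^N_s,\alpha^i(s,X^i_s,\mu^N_s))]$. $(\alpha,\tilde\alpha)_i$ denotes the vector with $i$-th entry $\tilde\alpha$ and all other entries $\alpha$; $J_i(t,\vec x,\alpha):=J_i(t,\vec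 x,(\alpha,\dots,\alpha))$, which by symmetry equals $J^N(t,x_i,\mu^N_{\vec x},\alpha)$ for a function $J^N$ not depending on $i$. Put $v^{N,L}_i(t,\vec x,\alpha):=\inf_{\tilde\alpha\in\mathcal A^L_{state}}J_i(t,\vec x,(\alpha,\tilde\alpha)_i)$. $\mathcal M^{N,\varepsilon,L}_{state}(t,\mu^N_{\vec x})$ is the set of $\alpha^*\in\mathcal A^L_{state}$ with $J_i(t,\vec x,\alpha^* )\le v^{N,L}_i(t,\vec x,\alpha^* )+\varepsilon$ for all $i=1,\dots,N$ (it depends on $\vec x$ only through $\mu^N_{\vec x}$). For $\mu\in\mathcal P_N(\mathbb S)$, $\mathbb V^{N,\varepsilon,L}_{state}(t,\mu):=\{\varphi\in\mathbb L^0(\mathbb S;\mathbb R):\exists\alpha^*\in\mathcal M^{N,\varepsilon,L}_{state}(t,\mu)\text{ with }\|\varphi-J^N(t,\cdot,\mu,\alpha^* )\|_\infty\le\varepsilon\}$. *)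

theory Defs
  imports "HOL-Probability.Probability" "HOL-Combinatorics.Combinatorics"
begin

definition set_limsup :: "(nat \<Rightarrow> 'b set) \<Rightarrow> 'b set" where
  "set_limsup E = (\<Inter>n\<in>{1..}. \<Union>N\<in>{n..}. E N)"

definition set_liminf :: "(nat \<Rightarrow> 'b set) \<Rightarrow> 'b set" where
  "set_liminf E = (\<Union>n\<in>{1..}. \<Inter>N\<in>{n..}. E N)"

definition sup_norm :: "('s::finite \<Rightarrow> real) \<Rightarrow> real" where
  "sup_norm f = Max (range (\<lambda>x. \<bar>f x\<bar>))"

text \<open>The state space is a finite type, and probability measures on it are \<^typ>\<open>'s pmf\<close>.\<close>

definition W1 :: "'s::finite pmf \<Rightarrow> 's pmf \<Rightarrow> real" where
  "W1 \<mu> \<nu> = (\<Sum>x\<in>UNIV. \<bar>pmf \<mu> x - pmf \<nu> x\<bar>)"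

definition P0 :: "'s::finite pmf set" where
  "P0 = {\<mu>. set_pmf \<mu> = UNIV}"

text \<open>The sigma-algebra generated by the evaluations \<open>\<mu> \<mapsto> \<mu> B\<close>; as the state space is finite,
  it is the Borel sigma-algebra of \<^const>\<open>W1\<close>.\<close>

definition pmf_space :: "'s::finite pmf measure" where
  "pmf_space = vimage_algebra UNIV measure_pmf (subprob_algebra (count_space UNIV))"

definition modulus_of_continuity :: "(real \<Rightarrow> real) \<Rightarrow> bool" where
  "modulus_of_continuity \<rho> \<longleftrightarrow> (\<forall>r\<ge>0. 0 \<le> \<rho> r) \<and> \<rho> 0 = 0 \<and> (\<rho> \<longlongrightarrow> 0) (at_right 0)"

text \<open>
  \<open>path_law K t m n\<close> is the law of the canonical process \<open>X\<close> whose value at time \<open>t\<close> has law \<open>m\<close>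
  and which moves, for \<open>t \<le> s < t + n\<close>, from \<open>X s\<close> to \<open>X (s + 1)\<close> by the kernel \<open>K s (law of X s)\<close>.
  Kernels ignoring their second argument give ordinary Markov chains. Paths are functions on all
  of \<^typ>\<open>nat\<close>; outside \<open>{t..t + n}\<close> they are frozen at \<open>X t\<close>, and these coordinates are never used.
\<close>

fun path_law :: "(nat \<Rightarrow> 'x pmf \<Rightarrow> 'x \<Rightarrow> 'x pmf) \<Rightarrow> nat \<Rightarrow> 'x pmf \<Rightarrow> nat \<Rightarrow> (nat \<Rightarrow> 'x) pmf" where
  "path_law K t m 0 = map_pmf (\<lambda>x _. x) m"
| "path_law K t m (Suc n) =
     (let P = path_law K t m n; s = t + n in
      bind_pmf P (\<lambda>w. map_pmf (\<lambda>y. w(Suc s := y)) (K s (map_pmf (\<lambda>w. w s) P) (w s))))"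

lemma path_law_initial: "map_pmf (\<lambda>w. w t) (path_law K t m n) = m"
proof (induction n)
  case 0
  then show ?case by (simp add: pmf.map_comp o_def)
next
  case (Suc n)
  then show ?case
    by (simp add: Let_def map_bind_pmf pmf.map_comp o_def) (simp add: map_pmf_def)
qed

text \<open>Given the path up to time \<open>t + k\<close>, the next position has law \<open>K (t + k) (law of X (t + k)) (X (t + k))\<close>.\<close>

lemma path_law_transition:
  "map_pmf (\<lambda>w. (\<lambda>s. if s \<le> t + k then w s else undefined, w (Suc (t + k)))) (path_law K t m (Suc (k + j))) =
   bind_pmf (path_law K t m (k + j))
     (\<lambda>w. map_pmf (Pair (\<lambda>s. if s \<le> t + k then w s else undefined))
       (K (t + k) (map_pmf (\<lambda>w. w (t + k)) (path_law K t m (k + j))) (w (t + k))))"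
proof (induction j)
  case 0
  show ?case
    by (simp add: Let_def map_bind_pmf pmf.map_comp o_def cong: if_cong)
next
  case (Suc j)
  have frz: "map_pmf f (path_law K t m (Suc i)) = map_pmf f (path_law K t m i)"
    if "\<And>w y. f (w(Suc (t + i) := y)) = f w" for i and f :: "(nat \<Rightarrow> 'a) \<Rightarrow> 'c"
    by (simp add: Let_def map_bind_pmf pmf.map_comp o_def that) (simp add: map_pmf_def)
  let ?r = "\<lambda>w :: nat \<Rightarrow> 'a. (\<lambda>s. if s \<le> t + k then w s else undefined, w (t + k))"
  have r: "map_pmf ?r (path_law K t m (k + Suc j)) = map_pmf ?r (path_law K t m (k + j))"
    unfolding add_Suc_right by (rule frz) (auto simp: fun_eq_iff)
  have m: "map_pmf (\<lambda>w. w (t + k)) (path_law K t m (k + Suc j)) = map_pmf (\<lambda>w. w (t + k)) (path_law K t m (k + j))"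
    unfolding add_Suc_right by (rule frz) auto
  have split: "bind_pmf P (\<lambda>w. map_pmf (Pair (\<lambda>s. if s \<le> t + k then w s else undefined)) (Q (w (t + k)))) =
      bind_pmf (map_pmf ?r P) (\<lambda>(a, b). map_pmf (Pair a) (Q b))" for P and Q :: "'a \<Rightarrow> 'a pmf"
    by (simp add: bind_map_pmf)
  have "map_pmf (\<lambda>w. (\<lambda>s. if s \<le> t + k then w s else undefined, w (Suc (t + k)))) (path_law K t m (Suc (k + Suc j)))
     = map_pmf (\<lambda>w. (\<lambda>s. if s \<le> t + k then w s else undefined, w (Suc (t + k)))) (path_law K t m (k + Suc j))"
    by (rule frz) (auto simp: fun_eq_iff)
  then show ?case
    using Suc unfolding split r m by simp
qed

definition empirical :: "nat \<Rightarrow> (nat \<Rightarrow> 's::finite) \<Rightarrow> 's pmf" where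
  "empirical N xs = map_pmf xs (pmf_of_set {1..N})"

definition S0 :: "nat \<Rightarrow> (nat \<Rightarrow> 's::finite) set" where
  "S0 N = {xs \<in> {1..N} \<rightarrow>\<^sub>E UNIV. empirical N xs \<in> P0}"

locale mean_field_game =
  fixes T :: nat
    and A :: "'a::euclidean_space set"
    and q :: "nat \<Rightarrow> 's::finite \<Rightarrow> 's pmf \<Rightarrow> 'a \<Rightarrow> 's pmf"
    and F :: "nat \<Rightarrow> 's \<Rightarrow> 's pmf \<Rightarrow> 'a \<Rightarrow> real"
    and G :: "'s \<Rightarrow> 's pmf \<Rightarrow> real"
  assumes A_measurable: "A \<in> sets borel"
    and q_range: "\<And>s x \<mu> a y. s \<le> T \<Longrightarrow> a \<in> A \<Longrightarrow> pmf (q s x \<mu> a) y \<in> {0<..<1}"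
    and F_measurable: "\<And>s x. s \<le> T \<Longrightarrow>
      (\<lambda>(\<mu>, a). F s x \<mu> a) \<in> borel_measurable (pmf_space \<Otimes>\<^sub>M restrict_space borel A)"
    and G_measurable: "\<And>x. G x \<in> borel_measurable pmf_space"
begin

definition A_state :: "(nat \<Rightarrow> 's \<Rightarrow> 'a) set" where
  "A_state = {\<alpha>. \<forall>s\<le>T. \<forall>x. \<alpha> s x \<in> A}"

definition mf_flow :: "nat \<Rightarrow> 's pmf \<Rightarrow> (nat \<Rightarrow> 's \<Rightarrow> 'a) \<Rightarrow> nat \<Rightarrow> 's pmf" where
  "mf_flow t \<mu> \<alpha> s =
     map_pmf (\<lambda>w. w s) (path_law (\<lambda>r m x. q r x m (\<alpha> r x)) t \<mu> (T - t))"

definition tagged_law :: "(nat \<Rightarrow> 's pmf) \<Rightarrow> nat \<Rightarrow> 's \<Rightarrow> (nat \<Rightarrow> 's \<Rightarrow> 'a) \<Rightarrow> (nat \<Rightarrow> 's) pmf" where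
  "tagged_law \<mu>s t x \<alpha> = path_law (\<lambda>r _ y. q r y (\<mu>s r) (\<alpha> r y)) t (return_pmf x) (T - t)"

definition J_flow :: "(nat \<Rightarrow> 's pmf) \<Rightarrow> nat \<Rightarrow> 's \<Rightarrow> (nat \<Rightarrow> 's \<Rightarrow> 'a) \<Rightarrow> real" where
  "J_flow \<mu>s t x \<alpha> = measure_pmf.expectation (tagged_law \<mu>s t x \<alpha>)
     (\<lambda>X. G (X T) (\<mu>s T) + (\<Sum>r\<in>{t..<T}. F r (X r) (\<mu>s r) (\<alpha> r (X r))))"

definition J :: "nat \<Rightarrow> 's pmf \<Rightarrow> (nat \<Rightarrow> 's \<Rightarrow> 'a) \<Rightarrow> 's \<Rightarrow> (nat \<Rightarrow> 's \<Rightarrow> 'a) \<Rightarrow> real" where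
  "J t \<mu> \<alpha> x \<alpha>' = J_flow (mf_flow t \<mu> \<alpha>) t x \<alpha>'"

definition v :: "(nat \<Rightarrow> 's pmf) \<Rightarrow> nat \<Rightarrow> 's \<Rightarrow> real" where
  "v \<mu>s t x = (INF \<alpha>\<in>A_state. J_flow \<mu>s t x \<alpha>)"

definition M_state :: "real \<Rightarrow> nat \<Rightarrow> 's pmf \<Rightarrow> (nat \<Rightarrow> 's \<Rightarrow> 'a) set" where
  "M_state \<epsilon> t \<mu> = {\<alpha> \<in> A_state. \<forall>x. J t \<mu> \<alpha> x \<alpha> \<le> v (mf_flow t \<mu> \<alpha>) t x + \<epsilon>}"

definition V_state_eps :: "real \<Rightarrow> nat \<Rightarrow> 's pmf \<Rightarrow> ('s \<Rightarrow> real) set" where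
  "V_state_eps \<epsilon> t \<mu> = {\<phi>. \<exists>\<alpha>\<in>M_state \<epsilon> t \<mu>. sup_norm (\<lambda>x. \<phi> x - J t \<mu> \<alpha> x \<alpha>) \<le> \<epsilon>}"

definition V_state :: "nat \<Rightarrow> 's pmf \<Rightarrow> ('s \<Rightarrow> real) set" where
  "V_state t \<mu> = (\<Inter>\<epsilon>\<in>{0<..}. V_state_eps \<epsilon> t \<mu>)"

definition A_state_Lip :: "real \<Rightarrow> (nat \<Rightarrow> 's \<Rightarrow> 's pmf \<Rightarrow> 'a) set" where
  "A_state_Lip L = {\<alpha>. \<forall>s\<le>T. \<forall>x.
     (\<forall>\<mu>. \<alpha> s x \<mu> \<in> A) \<and> (\<forall>\<mu> \<nu>. norm (\<alpha> s x \<mu> - \<alpha> s x \<nu>) \<le> L * W1 \<mu> \<nu>)}"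

text \<open>The players are \<open>1, \<dots>, N\<close>; a vector of states or controls is a function on player indices,
  and vectors of states take the value \<^const>\<open>undefined\<close> outside \<open>{1..N}\<close>.\<close>

definition players_law ::
  "nat \<Rightarrow> nat \<Rightarrow> (nat \<Rightarrow> 's) \<Rightarrow> (nat \<Rightarrow> nat \<Rightarrow> 's \<Rightarrow> 's pmf \<Rightarrow> 'a) \<Rightarrow> (nat \<Rightarrow> nat \<Rightarrow> 's) pmf" where
  "players_law N t xs \<alpha>s =
     path_law (\<lambda>s _ ys. Pi_pmf {1..N} undefined
                 (\<lambda>i. q s (ys i) (empirical N ys) (\<alpha>s i s (ys i) (empirical N ys))))
       t (return_pmf xs) (T - t)"

definition J_player ::
  "nat \<Rightarrow> nat \<Rightarrow> nat \<Rightarrow> (nat \<Rightarrow> 's) \<Rightarrow> (nat \<Rightarrow> nat \<Rightarrow> 's \<Rightarrow> 's pmf \<Rightarrow> 'a) \<Rightarrow> real" where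
  "J_player N i t xs \<alpha>s = measure_pmf.expectation (players_law N t xs \<alpha>s)
     (\<lambda>X. G (X T i) (empirical N (X T)) +
       (\<Sum>s\<in>{t..<T}. F s (X s i) (empirical N (X s)) (\<alpha>s i s (X s i) (empirical N (X s)))))"

text \<open>The common value of \<open>J_player N i t xs (\<lambda>_. \<alpha>)\<close> over all \<open>xs\<close> and \<open>i\<close> with empirical
  measure \<open>\<mu>\<close> and \<open>xs i = x\<close>; see \<open>J_player_eq_J_N\<close> below.\<close>

definition J_N :: "nat \<Rightarrow> nat \<Rightarrow> 's \<Rightarrow> 's pmf \<Rightarrow> (nat \<Rightarrow> 's \<Rightarrow> 's pmf \<Rightarrow> 'a) \<Rightarrow> real" where
  "J_N N t x \<mu> \<alpha> = (THE j. \<forall>xs\<in>S0 N. \<forall>i\<in>{1..N}.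
     empirical N xs = \<mu> \<and> xs i = x \<longrightarrow> J_player N i t xs (\<lambda>_. \<alpha>) = j)"

definition v_N :: "nat \<Rightarrow> real \<Rightarrow> nat \<Rightarrow> nat \<Rightarrow> (nat \<Rightarrow> 's) \<Rightarrow> (nat \<Rightarrow> 's \<Rightarrow> 's pmf \<Rightarrow> 'a) \<Rightarrow> real" where
  "v_N N L i t xs \<alpha> = (INF \<alpha>'\<in>A_state_Lip L. J_player N i t xs ((\<lambda>_. \<alpha>)(i := \<alpha>')))"

definition M_N_at :: "nat \<Rightarrow> real \<Rightarrow> real \<Rightarrow> nat \<Rightarrow> (nat \<Rightarrow> 's) \<Rightarrow> (nat \<Rightarrow> 's \<Rightarrow> 's pmf \<Rightarrow> 'a) set" where
  "M_N_at N \<epsilon> L t xs = {\<alpha> \<in> A_state_Lip L.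
     \<forall>i\<in>{1..N}. J_player N i t xs (\<lambda>_. \<alpha>) \<le> v_N N L i t xs \<alpha> + \<epsilon>}"

text \<open>\<open>M_N_at N \<epsilon> L t xs\<close> depends on \<open>xs\<close> only through its empirical measure, by \<open>M_N_eq\<close> below.\<close>

definition M_N :: "nat \<Rightarrow> real \<Rightarrow> real \<Rightarrow> nat \<Rightarrow> 's pmf \<Rightarrow> (nat \<Rightarrow> 's \<Rightarrow> 's pmf \<Rightarrow> 'a) set" where
  "M_N N \<epsilon> L t \<mu> = (\<Union>xs\<in>{xs \<in> S0 N. empirical N xs = \<mu>}. M_N_at N \<epsilon> L t xs)"

definition V_N :: "nat \<Rightarrow> real \<Rightarrow> real \<Rightarrow> nat \<Rightarrow> 's pmf \<Rightarrow> ('s \<Rightarrow> real) set" where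
  "V_N N \<epsilon> L t \<mu> = {\<phi>. \<exists>\<alpha>\<in>M_N N \<epsilon> L t \<mu>. sup_norm (\<lambda>x. \<phi> x - J_N N t x \<mu> \<alpha>) \<le> \<epsilon>}"

end

text \<open>Invariance of the \<open>N\<close>-player game under relabelling of the players.\<close>

lemma empirical_permute:
  assumes "p permutes {1..N}" "N \<noteq> 0"
  shows "empirical N (xs \<circ> p) = empirical N xs"
proof -
  have "map_pmf p (pmf_of_set {1..N}) = pmf_of_set {1..N}"
    using assms by (intro map_pmf_of_set_bij_betw permutes_imp_bij) auto
  then show ?thesis
    unfolding empirical_def by (metis pmf.map_comp)
qed

lemma empirical_eq_permutes:
  assumes "empirical N xs = empirical N ys" "N \<noteq> 0" "i \<in> {1..N}" "j \<in> {1..N}" "xs i = ys j"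
  obtains p where "p permutes {1..N}" "\<forall>k\<in>{1..N}. xs k = ys (p k)" "p i = j"
proof -
  have ne: "{1..N} \<noteq> {}" using assms(2) by auto
  have c: "card ({1..N} \<inter> zs -` {y}) = N * pmf (empirical N zs) y" for zs :: "nat \<Rightarrow> 'a" and y
    using ne assms(2) by (simp add: empirical_def pmf_map measure_pmf_of_set)
  have "image_mset xs (mset_set {1..N}) = image_mset ys (mset_set {1..N})"
  proof (rule multiset_eqI)
    fix y
    have "real (card ({1..N} \<inter> xs -` {y})) = real (card ({1..N} \<inter> ys -` {y}))"
      unfolding c assms(1) ..
    then show "count (image_mset xs (mset_set {1..N})) y = count (image_mset ys (mset_set {1..N})) y"
      by (simp add: count_image_mset Int_commute)
  qed
  then obtain p where p: "p permutes {1..N}" "\<forall>k\<in>{1..N}. xs k = ys (p k)"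
    using image_mset_eq_implies_permutes[of "{1..N}" xs ys] by auto
  let ?p = "Transposition.transpose (p i) j \<circ> p"
  have "p i \<in> {1..N}" using p(1) assms(3) by (metis permutes_in_image)
  then have "?p permutes {1..N}"
    using p(1) assms(4) by (intro permutes_compose permutes_swap_id)
  moreover have "\<forall>k\<in>{1..N}. xs k = ys (?p k)"
    using p(2) assms(3,5) by (auto simp: Transposition.transpose_def)
  moreover have "?p i = j" by simp
  ultimately show ?thesis by (rule that)
qed

lemma Pi_pmf_permute:
  fixes h :: "'a \<Rightarrow> 'b pmf"
  assumes "p permutes I" "finite I"
  shows "Pi_pmf I d (\<lambda>i. h (p i)) = map_pmf (\<lambda>f. f \<circ> p) (Pi_pmf I d h)"
proof (rule pmf_eqI)
  fix g :: "'a \<Rightarrow> 'b"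
  have inj: "inj (\<lambda>f :: 'a \<Rightarrow> 'b. f \<circ> p)"
    using permutes_surj[OF assms(1)] by (auto intro!: injI simp: fun_eq_iff) (metis surjD)
  let ?g = "g \<circ> inv p"
  have gg: "g = ?g \<circ> p" using permutes_inv_o[OF assms(1)] by (simp add: o_assoc[symmetric])
  have "pmf (map_pmf (\<lambda>f. f \<circ> p) (Pi_pmf I d h)) g = pmf (Pi_pmf I d h) ?g"
    by (subst gg, rule pmf_map_inj'[OF inj])
  also have "\<dots> = pmf (Pi_pmf I d (\<lambda>i. h (p i))) g"
  proof -
    have out: "(\<forall>x. x \<notin> I \<longrightarrow> ?g x = d) \<longleftrightarrow> (\<forall>x. x \<notin> I \<longrightarrow> g x = d)"
      by (auto simp: permutes_not_in[OF assms(1)] permutes_not_in[OF permutes_inv[OF assms(1)]])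
    have "(\<Prod>x\<in>I. pmf (h x) (?g x)) = (\<Prod>x\<in>I. pmf (h (p x)) (?g (p x)))"
      by (rule prod.permute[OF assms(1), unfolded o_def])
    then show ?thesis
      by (simp only: pmf_Pi[OF assms(2)] out) (auto simp: permutes_inverses[OF assms(1)])
  qed
  finally show "pmf (Pi_pmf I d (\<lambda>i. h (p i))) g = pmf (map_pmf (\<lambda>f. f \<circ> p) (Pi_pmf I d h)) g" ..
qed

context mean_field_game
begin

lemma players_law_permute:
  assumes p: "p permutes {1..N}" and N: "N \<noteq> 0"
  shows "players_law N t (xs \<circ> p) (\<alpha>s \<circ> p) = map_pmf (\<lambda>X s. X s \<circ> p) (players_law N t xs \<alpha>s)"
proof -
  let ?K = "\<lambda>\<alpha>s s (_ :: (nat \<Rightarrow> 's) pmf) ys. Pi_pmf {1..N} undefined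
                 (\<lambda>i. q s (ys i) (empirical N ys) (\<alpha>s i s (ys i) (empirical N ys)))"
  have K: "?K (\<alpha>s \<circ> p) s m (ys \<circ> p) = map_pmf (\<lambda>f. f \<circ> p) (?K \<alpha>s s m' ys)"
    for s ys and m m' :: "(nat \<Rightarrow> 's) pmf"
    using Pi_pmf_permute[OF p, of undefined "\<lambda>i. q s (ys i) (empirical N ys) (\<alpha>s i s (ys i) (empirical N ys))"]
    unfolding empirical_permute[OF p N] by simp
  have "path_law (?K (\<alpha>s \<circ> p)) t (return_pmf (xs \<circ> p)) n =
        map_pmf (\<lambda>X s. X s \<circ> p) (path_law (?K \<alpha>s) t (return_pmf xs) n)" for n
  proof (induction n)
    case 0
    show ?case by simp
  next
    case (Suc n)
    show ?case
      unfolding path_law.simps Let_def Suc map_bind_pmf bind_map_pmf K pmf.map_comp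
      by (intro bind_pmf_cong refl map_pmf_cong) (auto simp: fun_eq_iff)
  qed
  then show ?thesis unfolding players_law_def by blast
qed

lemma J_player_permute:
  assumes p: "p permutes {1..N}" and N: "N \<noteq> 0"
  shows "J_player N i t (xs \<circ> p) (\<alpha>s \<circ> p) = J_player N (p i) t xs \<alpha>s"
  unfolding J_player_def players_law_permute[OF p N]
  by (simp add: empirical_permute[OF p N])

lemma S0_pos: "xs \<in> S0 N \<Longrightarrow> i \<in> {1..N} \<Longrightarrow> N \<noteq> 0"
  by auto

lemma S0_permutes:
  assumes "xs \<in> S0 N" "ys \<in> S0 N" "empirical N xs = empirical N ys"
    and "i \<in> {1..N}" "j \<in> {1..N}" "xs i = ys j"
  obtains p where "p permutes {1..N}" "xs = ys \<circ> p" "p i = j"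
proof -
  have "N \<noteq> 0" using assms(4) by auto
  from empirical_eq_permutes[OF assms(3) this assms(4-6)] obtain p
    where p: "p permutes {1..N}" "\<forall>k\<in>{1..N}. xs k = ys (p k)" "p i = j" .
  have "xs k = ys (p k)" for k
  proof (cases "k \<in> {1..N}")
    case False
    then show ?thesis
      using assms(1,2) permutes_not_in[OF p(1) False]
      by (auto simp: S0_def PiE_def extensional_def)
  qed (use p in auto)
  then have "xs = ys \<circ> p" by auto
  with p show ?thesis using that by blast
qed

lemma J_player_eq_J_N:
  assumes "xs \<in> S0 N" "i \<in> {1..N}"
  shows "J_player N i t xs (\<lambda>_. \<alpha>) = J_N N t (xs i) (empirical N xs) \<alpha>"
proof -
  have "J_player N j t ys (\<lambda>_. \<alpha>) = J_player N i t xs (\<lambda>_. \<alpha>)"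
    if ys: "ys \<in> S0 N" "j \<in> {1..N}" "empirical N ys = empirical N xs" "ys j = xs i" for ys j
  proof -
    obtain p where p: "p permutes {1..N}" "ys = xs \<circ> p" "p j = i"
      using S0_permutes[OF ys(1) assms(1) ys(3,2) assms(2) ys(4)] .
    show ?thesis
      using J_player_permute[OF p(1), of j t xs "\<lambda>_. \<alpha>"] assms(2) p by (auto simp: o_def)
  qed
  then show ?thesis
    unfolding J_N_def using assms by (intro the_equality[symmetric]) blast+
qed

lemma M_N_at_cong:
  assumes xs: "xs \<in> S0 N" and ys: "ys \<in> S0 N" and e: "empirical N xs = empirical N ys"
  shows "M_N_at N \<epsilon> L t xs \<subseteq> M_N_at N \<epsilon> L t ys"
proof
  fix \<alpha> assume \<alpha>: "\<alpha> \<in> M_N_at N \<epsilon> L t xs"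
  have "J_player N i t ys (\<lambda>_. \<alpha>) \<le> v_N N L i t ys \<alpha> + \<epsilon>" if i: "i \<in> {1..N}" for i
  proof -
    have "xs ` {1..N} = UNIV" if "xs \<in> S0 N" for xs :: "nat \<Rightarrow> 's"
      using that i by (auto simp: S0_def P0_def empirical_def)
    then obtain j where j: "j \<in> {1..N}" "xs j = ys i" using xs by (metis UNIV_I imageE)
    obtain p where p: "p permutes {1..N}" "xs = ys \<circ> p" "p j = i"
      using S0_permutes[OF xs ys e j(1) i j(2)] .
    have N: "N \<noteq> 0" using i by auto
    have "((\<lambda>_. \<alpha>)(i := \<alpha>')) \<circ> p = (\<lambda>_. \<alpha>)(j := \<alpha>')" for \<alpha>'
      using p(3) permutes_inj[OF p(1)] by (auto simp: fun_eq_iff inj_def)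
    then have 1: "J_player N j t xs ((\<lambda>_. \<alpha>)(j := \<alpha>')) = J_player N i t ys ((\<lambda>_. \<alpha>)(i := \<alpha>'))" for \<alpha>'
      using J_player_permute[OF p(1) N, of j t ys "(\<lambda>_. \<alpha>)(i := \<alpha>')"] p by simp
    from 1[of \<alpha>] have "J_player N j t xs (\<lambda>_. \<alpha>) = J_player N i t ys (\<lambda>_. \<alpha>)"
      by (simp add: fun_upd_idem)
    moreover have "v_N N L j t xs \<alpha> = v_N N L i t ys \<alpha>" by (simp add: v_N_def 1)
    moreover have "J_player N j t xs (\<lambda>_. \<alpha>) \<le> v_N N L j t xs \<alpha> + \<epsilon>"
      using \<alpha> j(1) by (auto simp: M_N_at_def)
    ultimately show ?thesis by simp
  qed
  with \<alpha> show "\<alpha> \<in> M_N_at N \<epsilon> L t ys" by (auto simp: M_N_at_def)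
qed

lemma M_N_eq: "xs \<in> S0 N \<Longrightarrow> M_N N \<epsilon> L t (empirical N xs) = M_N_at N \<epsilon> L t xs"
  unfolding M_N_def using M_N_at_cong by blast

end

end

theory Submission
  imports Defs
begin

text \<open>
  A symmetric feedback control \<open>\<alpha>\<close> that is \<open>L\<close>-Lipschitz in the measure generates a mean field flow
  \<open>\<mu>s\<close>, and freezing its measure argument along \<open>\<mu>s\<close> turns it into a control in \<open>A_state\<close> with the
  same flow. If one player deviates to \<open>\<alpha>'\<close>, the empirical measure of the \<open>N\<close> players stays close to
  \<open>\<mu>s\<close> (a deviation costs \<open>1 / N\<close>, and the fluctuations of a conditionally independent step are of
  order \<open>1 / sqrt N\<close>), and the law of the deviating player stays close to that of the mean field chain
  with the control \<open>\<alpha>'\<close> frozen along \<open>\<mu>s\<close>. Both errors satisfy linear recursions in time, so payoffs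
  of the two games differ by a quantity that vanishes uniformly over all \<open>L\<close>-Lipschitz \<open>\<alpha>\<close> and \<open>\<alpha>'\<close>.
  Hence approximate equilibria transfer in both directions at a small loss in \<open>\<epsilon>\<close>; controls in
  \<open>A_state\<close> are exactly the feedback controls with \<open>L = 0\<close>.
\<close>

section \<open>Expectations under probability mass functions\<close>

abbreviation E :: "'x pmf \<Rightarrow> ('x \<Rightarrow> real) \<Rightarrow> real" where
  "E p h \<equiv> measure_pmf.expectation p h"

lemma integrable_pmf_bounded:
  fixes h :: "'x \<Rightarrow> real"
  assumes "\<And>x. \<bar>h x\<bar> \<le> B"
  shows "integrable (measure_pmf p) h"
  by (rule measure_pmf.integrable_const_bound[where B = B]) (use assms in auto)

lemma abs_expectation_le:
  assumes "\<And>x. \<bar>h x\<bar> \<le> B"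
  shows "\<bar>E p h\<bar> \<le> B"
proof -
  have "\<bar>E p h\<bar> \<le> E p (\<lambda>x. \<bar>h x\<bar>)" by (rule integral_abs_bound)
  also have "\<dots> \<le> E p (\<lambda>_. B)"
    by (rule integral_mono) (use assms in \<open>auto intro!: integrable_pmf_bounded[where B = B]\<close>)
  finally show ?thesis by simp
qed

lemma expectation_affine:
  assumes h: "\<And>x. \<bar>h x\<bar> \<le> B" and k: "\<And>x. \<bar>k x\<bar> \<le> B'"
  shows "E p (\<lambda>x. a + b * h x + c * k x) = a + b * E p h + c * E p k"
proof -
  note [simp] = integrable_pmf_bounded[where h = h, OF h, of p] integrable_pmf_bounded[where h = k, OF k, of p]
  show ?thesis by simp
qed

text \<open>The tower property. One uniform bound on \<open>h\<close> supplies integrability under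
  all the laws \<open>f x\<close> at once.\<close>

lemma expectation_bind_pmf:
  assumes "\<And>x. \<bar>h x\<bar> \<le> B"
  shows "E (bind_pmf p f) h = E p (\<lambda>x. E (f x) h)"
  unfolding measure_pmf_bind
  by (rule integral_bind[where K = "count_space UNIV" and B = B and B' = 1])
    (use assms in \<open>auto simp: measure_pmf.emeasure_space_1 space_subprob_algebra intro!: prob_space_imp_subprob_space measure_pmf.prob_space_axioms\<close>)

section \<open>Fluctuations of the empirical measure of independent draws\<close>

text \<open>Coordinates are independent and centred, so second moments add up: when one coordinate
  is split off, the cross term has mean zero and the new square contributes at most 1.\<close>

lemma Pi_pmf_second_moment:
  fixes g :: "'i \<Rightarrow> 'x \<Rightarrow> real"
  assumes "finite I" and "\<And>i y. \<bar>g i y\<bar> \<le> 1" and "\<And>i. i \<in> I \<Longrightarrow> E (p i) (g i) = 0"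
  shows "E (Pi_pmf I d p) (\<lambda>f. (\<Sum>i\<in>I. g i (f i))\<^sup>2) \<le> card I"
  using assms(1,3)
proof (induction I)
  case (insert x I)
  let ?S = "\<lambda>f. \<Sum>i\<in>I. g i (f i)"
  let ?P = "Pi_pmf I d p"
  have S: "\<bar>?S f\<bar> \<le> card I" for f
    using sum_norm_bound[of I "\<lambda>i. g i (f i)" 1] assms(2) by simp
  have S2: "\<bar>(?S f)\<^sup>2\<bar> \<le> (card I)\<^sup>2" for f
    using power_mono[OF S abs_ge_zero, of f 2] by simp
  have g2: "\<bar>(g x y)\<^sup>2\<bar> \<le> 1" for y
    using power_mono[OF assms(2) abs_ge_zero, of x y 2] by simp
  have "\<bar>\<Sum>i\<in>insert x I. g i (f i)\<bar> \<le> card (insert x I)" for f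
    using sum_norm_bound[of "insert x I" "\<lambda>i. g i (f i)" 1] assms(2) by simp
  then have bd: "\<bar>(\<Sum>i\<in>insert x I. g i (f i))\<^sup>2\<bar> \<le> (card (insert x I))\<^sup>2" for f
    using power_mono[OF _ abs_ge_zero, of "\<Sum>i\<in>insert x I. g i (f i)" _ 2] by (metis of_nat_power power2_abs abs_power2)
  have inner: "E ?P (\<lambda>f. (g x y + ?S f)\<^sup>2) = (g x y)\<^sup>2 + 2 * g x y * E ?P ?S + E ?P (\<lambda>f. (?S f)\<^sup>2)" for y
  proof -
    have "E ?P (\<lambda>f. (g x y + ?S f)\<^sup>2) = E ?P (\<lambda>f. (g x y)\<^sup>2 + 2 * g x y * ?S f + (?S f)\<^sup>2)"
      by (simp add: power2_sum algebra_simps)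
    also have "\<dots> = (g x y)\<^sup>2 + 2 * g x y * E ?P ?S + E ?P (\<lambda>f. (?S f)\<^sup>2)"
      using expectation_affine[of ?S, OF S S2, of ?P "(g x y)\<^sup>2" "2 * g x y" 1] by simp
    finally show ?thesis .
  qed
  \<comment> \<open>The coordinate \<open>x\<close> is drawn first and the others independently of
    it, so the expectation can be iterated.\<close>
  have "E (Pi_pmf (insert x I) d p) (\<lambda>f. (\<Sum>i\<in>insert x I. g i (f i))\<^sup>2)
     = E (p x) (\<lambda>y. E ?P (\<lambda>f. (\<Sum>i\<in>insert x I. g i ((f(x := y)) i))\<^sup>2))"
    unfolding Pi_pmf_insert'[OF insert.hyps(1,2)] map_pmf_def[symmetric]
    by (subst expectation_bind_pmf[OF bd]) simp
  also have "\<dots> = E (p x) (\<lambda>y. E ?P (\<lambda>f. (g x y + ?S f)\<^sup>2))"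
    using insert.hyps by (auto intro!: Bochner_Integration.integral_cong sum.cong arg_cong[where f = "\<lambda>u. u\<^sup>2"])
  also have "\<dots> = E (p x) (\<lambda>y. (g x y)\<^sup>2 + 2 * E ?P ?S * g x y + E ?P (\<lambda>f. (?S f)\<^sup>2))"
    unfolding inner by (simp add: algebra_simps)
  also have "\<dots> = E (p x) (\<lambda>y. (g x y)\<^sup>2) + 2 * E ?P ?S * E (p x) (g x) + E ?P (\<lambda>f. (?S f)\<^sup>2)"
    using expectation_affine[of "g x", OF assms(2) g2, of "p x" "E ?P (\<lambda>f. (?S f)\<^sup>2)" "2 * E ?P ?S" 1]
    by (simp add: algebra_simps)
  \<comment> \<open>The cross term is a product of means, and the mean of \<open>g x\<close> is
    zero.\<close>
  also have "\<dots> \<le> 1 + 2 * E ?P ?S * 0 + card I"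
    using abs_expectation_le[of "\<lambda>y. (g x y)\<^sup>2" 1 "p x"] g2 insert by auto
  finally show ?case using insert.hyps by simp
qed simp

lemma pmf_empirical:
  assumes "N > 0"
  shows "pmf (empirical N f) z = (\<Sum>j\<in>{1..N}. indicator {z} (f j)) / N"
proof -
  have "pmf (empirical N f) z = card ({1..N} \<inter> f -` {z}) / N"
    using assms by (simp add: empirical_def pmf_map measure_pmf_of_set)
  also have "real (card ({1..N} \<inter> f -` {z})) = (\<Sum>j\<in>{1..N}. indicator {z} (f j))"
    by (simp add: indicator_def sum.If_cases vimage_def)
  finally show ?thesis .
qed

text \<open>The centred indicators of \<open>z\<close> are independent and bounded by 1, so their
  sum has second moment at most \<open>N\<close> and is of order \<open>sqrt N\<close>. The laws
  \<open>\<kappa> j\<close> may differ between players, as they must when players sit in different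
  states and one of them deviates.\<close>

lemma empirical_deviation:
  assumes N: "N > 0"
  shows "E (Pi_pmf {1..N} d \<kappa>) (\<lambda>f. \<bar>pmf (empirical N f) z - (\<Sum>j\<in>{1..N}. pmf (\<kappa> j) z) / N\<bar>) \<le> 1 / sqrt N"
proof -
  let ?P = "Pi_pmf {1..N} d \<kappa>"
  let ?g = "\<lambda>j y. indicator {z} y - pmf (\<kappa> j) z"
  let ?S = "\<lambda>f. \<Sum>j\<in>{1..N}. ?g j (f j)"
  have g: "\<bar>?g j y\<bar> \<le> 1" for j y by (auto simp: indicator_def pmf_le_1)
  have S: "\<bar>?S f\<bar> \<le> N" for f
    using sum_norm_bound[of "{1..N}" "\<lambda>j. ?g j (f j)" 1] g by simp
  have S2: "\<bar>(?S f)\<^sup>2\<bar> \<le> N\<^sup>2" for f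
    using power_mono[OF S abs_ge_zero, of f 2] by simp
  have E0: "E (\<kappa> j) (?g j) = 0" for j
    by (subst Bochner_Integration.integral_diff) (auto simp: pmf.rep_eq intro!: integrable_pmf_bounded[where B = 1])
  have m2: "E ?P (\<lambda>f. (?S f)\<^sup>2) \<le> N"
    using Pi_pmf_second_moment[of "{1..N}" ?g \<kappa> d] g E0 by simp
  have eq: "\<bar>pmf (empirical N f) z - (\<Sum>j\<in>{1..N}. pmf (\<kappa> j) z) / N\<bar> = \<bar>?S f\<bar> / N" for f
    unfolding pmf_empirical[OF N] by (simp add: sum_subtractf diff_divide_distrib[symmetric])
  \<comment> \<open>AM-GM: \<open>2 \<bar>S\<bar> \<le> S\<^sup>2 / sqrt N + sqrt N\<close>\<close>
  have amgm: "\<bar>?S f\<bar> / N \<le> (?S f)\<^sup>2 * (1 / (2 * N * sqrt N)) + 1 / (2 * sqrt N)" for f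
  proof -
    have "0 \<le> (\<bar>?S f\<bar> - sqrt N)\<^sup>2" by simp
    then have "2 * \<bar>?S f\<bar> * sqrt N \<le> (?S f)\<^sup>2 + N" by (simp add: power2_diff)
    then have "2 * \<bar>?S f\<bar> * sqrt N / (2 * N * sqrt N) \<le> ((?S f)\<^sup>2 + N) / (2 * N * sqrt N)"
      by (rule divide_right_mono) simp
    then show ?thesis using N by (simp add: field_simps)
  qed
  have i: "integrable (measure_pmf ?P) (\<lambda>f. (?S f)\<^sup>2)" "integrable (measure_pmf ?P) (\<lambda>f. \<bar>?S f\<bar>)"
    by (rule integrable_pmf_bounded[OF S2]) (rule integrable_pmf_bounded[where B = N], use S in simp)
  have "E ?P (\<lambda>f. \<bar>?S f\<bar> / N) \<le> E ?P (\<lambda>f. (?S f)\<^sup>2 * (1 / (2 * N * sqrt N)) + 1 / (2 * sqrt N))"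
    by (intro integral_mono amgm integrable_divide Bochner_Integration.integrable_add integrable_mult_left i) simp
  also have "\<dots> = E ?P (\<lambda>f. (?S f)\<^sup>2) * (1 / (2 * N * sqrt N)) + 1 / (2 * sqrt N)"
    using i by simp
  also have "\<dots> \<le> N * (1 / (2 * N * sqrt N)) + 1 / (2 * sqrt N)"
    using m2 by (intro add_mono mult_right_mono) auto
  also have "\<dots> = 1 / sqrt N" using N by (simp add: field_simps)
  finally show ?thesis unfolding eq .
qed

section \<open>The distance \<open>W1\<close> and expectations on the finite state space\<close>

lemma W1_nonneg: "0 \<le> W1 \<mu> \<nu>"
  by (simp add: W1_def sum_nonneg)

lemma W1_self [simp]: "W1 \<mu> \<mu> = 0"
  by (simp add: W1_def)

lemma W1_le_2: "W1 \<mu> \<nu> \<le> 2"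
proof -
  have "W1 \<mu> \<nu> \<le> (\<Sum>x\<in>UNIV. pmf \<mu> x + pmf \<nu> x)"
    unfolding W1_def by (intro sum_mono) (simp add: abs_le_iff pmf_nonneg add_increasing add_increasing2)
  then show ?thesis by (simp add: sum.distrib sum_pmf_eq_1)
qed

lemma abs_W1_le_2: "\<bar>W1 \<mu> \<nu>\<bar> \<le> 2"
  using W1_nonneg[of \<mu> \<nu>] W1_le_2[of \<mu> \<nu>] by simp

lemma expectation_finite_type:
  fixes p :: "'s::finite pmf"
  shows "E p h = (\<Sum>x\<in>UNIV. pmf p x * h x)"
  by (subst integral_measure_pmf_real[where A = UNIV]) (auto simp: mult.commute)

text \<open>\<open>W1\<close> is the l1 distance of the weights, so a bound on \<open>h\<close> is
  enough and no regularity in the state is involved.\<close>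

lemma expectation_diff_le_W1:
  fixes \<mu> \<nu> :: "'s::finite pmf"
  assumes "\<And>x. \<bar>h x\<bar> \<le> B"
  shows "\<bar>E \<nu> h - E \<mu> h\<bar> \<le> B * W1 \<nu> \<mu>"
proof -
  have "\<bar>E \<nu> h - E \<mu> h\<bar> = \<bar>\<Sum>x\<in>UNIV. h x * (pmf \<nu> x - pmf \<mu> x)\<bar>"
    unfolding expectation_finite_type by (simp add: sum_subtractf[symmetric] algebra_simps)
  also have "\<dots> \<le> (\<Sum>x\<in>UNIV. \<bar>h x\<bar> * \<bar>pmf \<nu> x - pmf \<mu> x\<bar>)"
    by (metis (no_types, lifting) abs_mult sum_abs sum.cong)
  also have "\<dots> \<le> (\<Sum>x\<in>UNIV. B * \<bar>pmf \<nu> x - pmf \<mu> x\<bar>)"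
    by (intro sum_mono mult_right_mono assms) simp
  finally show ?thesis by (simp add: W1_def sum_distrib_left)
qed

lemma expectation_empirical:
  assumes "N > 0"
  shows "E (empirical N ys) h = (\<Sum>j\<in>{1..N}. h (ys j)) / N"
  using assms by (simp add: empirical_def integral_pmf_of_set)

lemma abs_pmf_diff_le_1: "\<bar>pmf p x - pmf q x\<bar> \<le> 1"
  using pmf_le_1[of p x] pmf_le_1[of q x] pmf_nonneg[of p x] pmf_nonneg[of q x] by linarith

section \<open>One-step comparison of the players with the mean field\<close>

text \<open>Four errors add up in each state: the fluctuation \<open>1 / sqrt N\<close>, the
  deviating player's share \<open>1 / N\<close>, the distance of the present empirical measure to
  \<open>\<mu>\<close>, and the distance \<open>b\<close> between the kernels. Summing over states
  gives the factor \<open>CARD('s)\<close>.\<close>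

lemma empirical_step:
  fixes \<mu> :: "'s::finite pmf" and \<kappa> :: "nat \<Rightarrow> 's pmf"
  assumes N: "N > 0" and i: "i \<in> {1..N}"
    and \<kappa>: "\<And>j. j \<noteq> i \<Longrightarrow> \<kappa> j = Q (ys j)"
    and Q: "\<And>x z. \<bar>pmf (Q x) z - pmf (Q' x) z\<bar> \<le> b"
  shows "E (Pi_pmf {1..N} d \<kappa>) (\<lambda>f. W1 (empirical N f) (bind_pmf \<mu> Q'))
    \<le> CARD('s) * (1 / sqrt N + 1 / N + W1 (empirical N ys) \<mu> + b)"
proof -
  let ?P = "Pi_pmf {1..N} d \<kappa>" and ?\<nu> = "empirical N ys"
  \<comment> \<open>\<open>?c z\<close> is the expected weight of \<open>z\<close> after the step,
    the intermediate point between the random empirical weight and the mean field weight.\<close>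
  let ?c = "\<lambda>z. (\<Sum>j\<in>{1..N}. pmf (\<kappa> j) z) / N"
  have mean: "\<bar>?c z - pmf (bind_pmf \<mu> Q') z\<bar> \<le> 1 / N + W1 ?\<nu> \<mu> + b" for z
  proof -
    have "?c z - E ?\<nu> (\<lambda>x. pmf (Q x) z) = (\<Sum>j\<in>{1..N}. pmf (\<kappa> j) z - pmf (Q (ys j)) z) / N"
      by (simp add: expectation_empirical[OF N] sum_subtractf diff_divide_distrib)
    \<comment> \<open>All players other than \<open>i\<close> use \<open>Q\<close>, so a single
      summand survives.\<close>
    also have "(\<Sum>j\<in>{1..N}. pmf (\<kappa> j) z - pmf (Q (ys j)) z) = pmf (\<kappa> i) z - pmf (Q (ys i)) z"
      using i \<kappa> by (subst sum.remove[of _ i]) (auto intro!: sum.neutral)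
    finally have "\<bar>?c z - E ?\<nu> (\<lambda>x. pmf (Q x) z)\<bar> = \<bar>pmf (\<kappa> i) z - pmf (Q (ys i)) z\<bar> / N" by simp
    also have "\<dots> \<le> 1 / N"
      by (intro divide_right_mono abs_pmf_diff_le_1) simp
    finally have 1: "\<bar>?c z - E ?\<nu> (\<lambda>x. pmf (Q x) z)\<bar> \<le> 1 / N" .
    have 2: "\<bar>E ?\<nu> (\<lambda>x. pmf (Q x) z) - E \<mu> (\<lambda>x. pmf (Q x) z)\<bar> \<le> 1 * W1 ?\<nu> \<mu>"
      by (rule expectation_diff_le_W1) (simp add: pmf_le_1)
    have "E \<mu> (\<lambda>x. pmf (Q x) z) - E \<mu> (\<lambda>x. pmf (Q' x) z) = E \<mu> (\<lambda>x. pmf (Q x) z - pmf (Q' x) z)"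
      by (intro Bochner_Integration.integral_diff[symmetric] integrable_measure_pmf_finite) auto
    then have 3: "\<bar>E \<mu> (\<lambda>x. pmf (Q x) z) - E \<mu> (\<lambda>x. pmf (Q' x) z)\<bar> \<le> b"
      using abs_expectation_le[of "\<lambda>x. pmf (Q x) z - pmf (Q' x) z" b \<mu>] Q by simp
    show ?thesis using 1 2 3 unfolding pmf_bind by linarith
  qed
  have b1: "\<bar>\<bar>pmf p z - pmf p' z\<bar>\<bar> \<le> 1" for p p' :: "'s pmf" and z
    unfolding abs_abs by (rule abs_pmf_diff_le_1)
  have c1: "0 \<le> ?c z" "?c z \<le> 1" for z
    using sum_mono[of "{1..N}" "\<lambda>j. pmf (\<kappa> j) z" "\<lambda>_. 1"] N
    by (auto simp: field_simps pmf_le_1 intro!: sum_nonneg)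
  have b2: "\<bar>\<bar>pmf p z - ?c z\<bar>\<bar> \<le> 1" for p and z
    using pmf_le_1[of p z] pmf_nonneg[of p z] c1[of z] unfolding abs_abs by (subst abs_le_iff) linarith
  have int1: "integrable (measure_pmf ?P) (\<lambda>f. \<bar>pmf (empirical N f) z - pmf p z\<bar>)" for z :: 's and p
    by (rule integrable_pmf_bounded, rule b1)
  have int2: "integrable (measure_pmf ?P) (\<lambda>f. \<bar>pmf (empirical N f) z - ?c z\<bar>)" for z :: 's
    by (rule integrable_pmf_bounded, rule b2)
  have "E ?P (\<lambda>f. W1 (empirical N f) (bind_pmf \<mu> Q'))
      = (\<Sum>z\<in>UNIV. E ?P (\<lambda>f. \<bar>pmf (empirical N f) z - pmf (bind_pmf \<mu> Q') z\<bar>))"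
    unfolding W1_def by (intro Bochner_Integration.integral_sum int1)
  also have "\<dots> \<le> (\<Sum>z\<in>(UNIV::'s set). 1 / sqrt N + (1 / N + W1 ?\<nu> \<mu> + b))"
  proof (intro sum_mono)
    fix z :: 's
    have "E ?P (\<lambda>f. \<bar>pmf (empirical N f) z - pmf (bind_pmf \<mu> Q') z\<bar>)
       \<le> E ?P (\<lambda>f. \<bar>pmf (empirical N f) z - ?c z\<bar> + \<bar>?c z - pmf (bind_pmf \<mu> Q') z\<bar>)"
      by (intro integral_mono int1 int2 Bochner_Integration.integrable_add) auto
    also have "\<dots> = E ?P (\<lambda>f. \<bar>pmf (empirical N f) z - ?c z\<bar>) + \<bar>?c z - pmf (bind_pmf \<mu> Q') z\<bar>"
      using int2[of z] by simp
    also have "\<dots> \<le> 1 / sqrt N + (1 / N + W1 ?\<nu> \<mu> + b)"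
      by (intro add_mono empirical_deviation N mean)
    finally show "E ?P (\<lambda>f. \<bar>pmf (empirical N f) z - pmf (bind_pmf \<mu> Q') z\<bar>) \<le> 1 / sqrt N + (1 / N + W1 ?\<nu> \<mu> + b)" .
  qed
  also have "\<dots> = CARD('s) * (1 / sqrt N + 1 / N + W1 ?\<nu> \<mu> + b)" by (simp add: add.assoc)
  finally show ?thesis .
qed

text \<open>Here \<open>y\<close> is a configuration of all players, \<open>\<pi>\<close> picks the
  tagged one and \<open>\<epsilon>\<close> takes the empirical measure. First \<open>H\<close> is
  replaced pointwise by \<open>h\<close> at the tagged state, then the law of that state by
  \<open>p\<close>. The lemma serves both transition probabilities and costs.\<close>

lemma coupled_expectation_le:
  fixes \<mu> p :: "'s::finite pmf" and P :: "'y pmf"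
  assumes h: "\<And>x. \<bar>h x\<bar> \<le> B" and H: "\<And>y. \<bar>H y\<bar> \<le> B"
    and Hh: "\<And>y. \<bar>H y - h (\<pi> y)\<bar> \<le> b + K * W1 (\<epsilon> y) \<mu>"
  shows "\<bar>E P H - E p h\<bar> \<le> b + K * E P (\<lambda>y. W1 (\<epsilon> y) \<mu>) + B * W1 (map_pmf \<pi> P) p"
proof -
  have iW: "integrable (measure_pmf P) (\<lambda>y. W1 (\<epsilon> y) \<mu>)"
    by (rule integrable_pmf_bounded[OF abs_W1_le_2])
  have iH: "integrable (measure_pmf P) H" "integrable (measure_pmf P) (\<lambda>y. h (\<pi> y))"
    by (rule integrable_pmf_bounded[OF H]) (rule integrable_pmf_bounded[OF h])
  have "\<bar>E P H - E P (\<lambda>y. h (\<pi> y))\<bar> = \<bar>E P (\<lambda>y. H y - h (\<pi> y))\<bar>"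
    using iH by simp
  also have "\<dots> \<le> E P (\<lambda>y. \<bar>H y - h (\<pi> y)\<bar>)"
    by (rule integral_abs_bound)
  also have "\<dots> \<le> E P (\<lambda>y. b + K * W1 (\<epsilon> y) \<mu>)"
    by (rule integral_mono) (use iH iW Hh in auto)
  also have "\<dots> = b + K * E P (\<lambda>y. W1 (\<epsilon> y) \<mu>)"
    using iW by simp
  finally have 1: "\<bar>E P H - E P (\<lambda>y. h (\<pi> y))\<bar> \<le> b + K * E P (\<lambda>y. W1 (\<epsilon> y) \<mu>)" .
  have "\<bar>E P (\<lambda>y. h (\<pi> y)) - E p h\<bar> \<le> B * W1 (map_pmf \<pi> P) p"
    using expectation_diff_le_W1[of h B "map_pmf \<pi> P" p, OF h] by simp
  with 1 show ?thesis by linarith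
qed

section \<open>Marginal laws and propagation of chaos\<close>

text \<open>\<open>marginal K t m n\<close> is the law at time \<open>t + n\<close>.\<close>

fun marginal :: "(nat \<Rightarrow> 'x pmf \<Rightarrow> 'x \<Rightarrow> 'x pmf) \<Rightarrow> nat \<Rightarrow> 'x pmf \<Rightarrow> nat \<Rightarrow> 'x pmf" where
  "marginal K t m 0 = m"
| "marginal K t m (Suc n) = bind_pmf (marginal K t m n) (K (t + n) (marginal K t m n))"

text \<open>The last step of the path rewrites only the newest coordinate, so earlier ones keep
  their laws. Payoffs are sums of functions of single coordinates, so marginals can replace path
  laws from here on.\<close>

lemma path_law_marginal_le:
  "k \<le> n \<Longrightarrow> map_pmf (\<lambda>w. w (t + k)) (path_law K t m n) = marginal K t m k"
proof (induction n arbitrary: k)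
  case 0
  then show ?case by (simp add: pmf.map_comp o_def)
next
  case (Suc n)
  show ?case
  proof (cases "k = Suc n")
    case True
    have "marginal K t m (Suc n) = bind_pmf (path_law K t m n)
        (\<lambda>w. K (t + n) (map_pmf (\<lambda>w. w (t + n)) (path_law K t m n)) (w (t + n)))"
      by (simp add: Suc.IH[symmetric] bind_map_pmf)
    then show ?thesis
      using True by (simp add: Let_def map_bind_pmf pmf.map_comp o_def)
  next
    case False
    then have "k \<le> n" using Suc.prems by simp
    then show ?thesis
      using Suc.IH[of k] by (simp add: Let_def map_bind_pmf pmf.map_comp o_def) (simp add: map_pmf_def)
  qed
qed

lemma path_law_marginal:
  "t \<le> s \<Longrightarrow> s \<le> t + n \<Longrightarrow> map_pmf (\<lambda>w. w s) (path_law K t m n) = marginal K t m (s - t)"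
  using path_law_marginal_le[of "s - t" n t K m] by simp

text \<open>Controls are absorbed into the kernels \<open>Q\<close> of the common players and
  \<open>R\<close> of player \<open>i\<close>, so that the estimates below concern Markov kernels
  only.\<close>

definition player_kernel ::
  "nat \<Rightarrow> nat \<Rightarrow> (nat \<Rightarrow> 's \<Rightarrow> 's pmf \<Rightarrow> 's pmf) \<Rightarrow> (nat \<Rightarrow> 's \<Rightarrow> 's pmf \<Rightarrow> 's pmf) \<Rightarrow>
    nat \<Rightarrow> (nat \<Rightarrow> 's::finite) \<Rightarrow> (nat \<Rightarrow> 's) pmf" where
  "player_kernel N i Q R s ys =
     Pi_pmf {1..N} undefined (\<lambda>j. (if j = i then R else Q) s (ys j) (empirical N ys))"

text \<open>A discrete Gronwall argument for the sum of two errors: the expected distance of the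
  empirical measure to the flow, and the distance between the laws of player \<open>i\<close> in the
  two systems. The bound sees \<open>Q\<close> and \<open>R\<close> only through
  \<open>\<beta>\<close>, which makes it uniform over controls.\<close>

lemma propagation_of_chaos:
  fixes Q R :: "nat \<Rightarrow> 's::finite \<Rightarrow> 's pmf \<Rightarrow> 's pmf" and \<mu>s :: "nat \<Rightarrow> 's pmf"
    and ys :: "nat \<Rightarrow> 's" and \<beta> :: real
  assumes N: "N > 0" and i: "i \<in> {1..N}" and \<beta>: "\<beta> \<ge> 0"
    and Q: "\<And>s x \<mu> \<nu> z. s < T \<Longrightarrow> \<bar>pmf (Q s x \<mu>) z - pmf (Q s x \<nu>) z\<bar> \<le> \<beta> * W1 \<mu> \<nu>"
    and R: "\<And>s x \<mu> \<nu> z. s < T \<Longrightarrow> \<bar>pmf (R s x \<mu>) z - pmf (R s x \<nu>) z\<bar> \<le> \<beta> * W1 \<mu> \<nu>"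
    and \<mu>s: "\<And>s. t \<le> s \<Longrightarrow> s < T \<Longrightarrow> \<mu>s (Suc s) = bind_pmf (\<mu>s s) (\<lambda>x. Q s x (\<mu>s s))"
    and n: "t + n \<le> T"
  defines "Y \<equiv> marginal (\<lambda>s _. player_kernel N i Q R s) t (return_pmf ys)"
    and "p \<equiv> marginal (\<lambda>s _ x. R s x (\<mu>s s)) t (return_pmf (ys i))"
  shows "E (Y n) (\<lambda>y. W1 (empirical N y) (\<mu>s (t + n))) + W1 (map_pmf (\<lambda>y. y i) (Y n)) (p n)
    \<le> (CARD('s) * (1 + 2 * \<beta>)) ^ n * (W1 (empirical N ys) (\<mu>s t) + n * (2 * real CARD('s) / sqrt N))"
  using n
proof (induction n)
  case 0
  show ?case by (simp add: Y_def p_def)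
next
  case (Suc n)
  let ?s = "t + n" and ?D = "real CARD('s)"
  let ?C = "?D * (1 + 2 * \<beta>)" and ?c = "2 * ?D / sqrt N"
  let ?e = "\<lambda>n. E (Y n) (\<lambda>y. W1 (empirical N y) (\<mu>s (t + n)))"
  let ?d = "\<lambda>n. W1 (map_pmf (\<lambda>y. y i) (Y n)) (p n)"
  have s: "t \<le> ?s" "?s < T" using Suc.prems by auto
  have YS: "Y (Suc n) = bind_pmf (Y n) (player_kernel N i Q R ?s)" by (simp add: Y_def)
  have e0: "0 \<le> ?e n" by (intro Bochner_Integration.integral_nonneg W1_nonneg)
  have iW: "integrable (measure_pmf (Y n)) (\<lambda>y. W1 (empirical N y) (\<mu>s ?s))"
    by (rule integrable_pmf_bounded[OF abs_W1_le_2])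
  have "?e (Suc n) = E (Y n) (\<lambda>y. E (player_kernel N i Q R ?s y) (\<lambda>f. W1 (empirical N f) (\<mu>s (Suc ?s))))"
    unfolding YS by (subst expectation_bind_pmf[OF abs_W1_le_2]) simp
  also have "\<dots> \<le> E (Y n) (\<lambda>y. ?D * (1 / sqrt N + 1 / N + W1 (empirical N y) (\<mu>s ?s) + \<beta> * W1 (empirical N y) (\<mu>s ?s)))"
  proof (rule integral_mono)
    show "integrable (measure_pmf (Y n)) (\<lambda>y. E (player_kernel N i Q R ?s y) (\<lambda>f. W1 (empirical N f) (\<mu>s (Suc ?s))))"
      by (rule integrable_pmf_bounded, rule abs_expectation_le, rule abs_W1_le_2)
    show "E (player_kernel N i Q R ?s y) (\<lambda>f. W1 (empirical N f) (\<mu>s (Suc ?s)))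
        \<le> ?D * (1 / sqrt N + 1 / N + W1 (empirical N y) (\<mu>s ?s) + \<beta> * W1 (empirical N y) (\<mu>s ?s))" for y
      unfolding player_kernel_def \<mu>s[OF s]
      \<comment> \<open>With the measure argument of \<open>Q\<close> fixed at the present empirical
        measure, the kernel error \<open>b\<close> is \<open>\<beta>\<close> times its distance to
        the flow.\<close>
      by (rule empirical_step[OF N i, where Q = "\<lambda>x. Q ?s x (empirical N y)"]) (use Q s in auto)
  qed (use iW in auto)
  also have "\<dots> = ?D * (1 / sqrt N + 1 / N + ?e n + \<beta> * ?e n)"
    using iW by simp
  finally have e: "?e (Suc n) \<le> ?D * (1 / sqrt N + 1 / N + ?e n + \<beta> * ?e n)" .
  have "map_pmf (\<lambda>y. y i) (Y (Suc n)) = bind_pmf (Y n) (\<lambda>y. R ?s (y i) (empirical N y))"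
    unfolding YS player_kernel_def map_bind_pmf using i by (simp add: Pi_pmf_component)
  moreover have "p (Suc n) = bind_pmf (p n) (\<lambda>x. R ?s x (\<mu>s ?s))" by (simp add: p_def)
  moreover have "\<bar>E (Y n) (\<lambda>y. pmf (R ?s (y i) (empirical N y)) z) - E (p n) (\<lambda>x. pmf (R ?s x (\<mu>s ?s)) z)\<bar>
      \<le> 0 + \<beta> * ?e n + 1 * ?d n" for z
    by (rule coupled_expectation_le) (use R[OF s(2)] in \<open>auto simp: pmf_le_1\<close>)
  ultimately have "?d (Suc n) \<le> (\<Sum>z\<in>(UNIV::'s set). \<beta> * ?e n + ?d n)"
    unfolding W1_def[of "map_pmf (\<lambda>y. y i) (Y (Suc n))"] by (intro sum_mono) (simp add: pmf_bind)
  then have d: "?d (Suc n) \<le> ?D * (\<beta> * ?e n + ?d n)" by simp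
  \<comment> \<open>The deviation cost \<open>1 / N\<close> is absorbed into
    \<open>1 / sqrt N\<close>, whence the 2 in the source term \<open>?c\<close>.\<close>
  have "sqrt N \<le> N"
    using N by (intro real_le_lsqrt) (auto simp: power2_eq_square)
  then have "1 / real N \<le> 1 / sqrt N"
    using N by (intro divide_left_mono) auto
  then have "?D * (1 / N) \<le> ?D * (1 / sqrt N)"
    by (rule mult_left_mono) simp
  then have "?e (Suc n) + ?d (Suc n) \<le> ?D * (2 / sqrt N + (1 + 2 * \<beta>) * ?e n + ?d n)"
  proof -
    have "?e (Suc n) \<le> ?D * (1 / sqrt N) + ?D * (1 / N) + ?D * ?e n + ?D * (\<beta> * ?e n)"
      using e by (simp only: distrib_left)
    moreover have "?d (Suc n) \<le> ?D * (\<beta> * ?e n) + ?D * ?d n"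
      using d by (simp only: distrib_left)
    moreover have "?D * (2 / sqrt N + (1 + 2 * \<beta>) * ?e n + ?d n)
        = 2 * (?D * (1 / sqrt N)) + ?D * ?e n + 2 * (?D * (\<beta> * ?e n)) + ?D * ?d n"
      by (simp add: algebra_simps)
    ultimately show ?thesis using \<open>?D * (1 / N) \<le> ?D * (1 / sqrt N)\<close> by linarith
  qed
  \<comment> \<open>Raising the coefficient of \<open>?d n\<close> to that of \<open>?e n\<close>
    closes the recursion for their sum.\<close>
  also have "\<dots> \<le> ?D * (2 / sqrt N + (1 + 2 * \<beta>) * ?e n + (1 + 2 * \<beta>) * ?d n)"
    using \<beta> W1_nonneg[of "map_pmf (\<lambda>y. y i) (Y n)" "p n"]
    by (intro mult_left_mono add_left_mono) (auto simp: distrib_right)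
  also have "\<dots> = ?C * (?e n + ?d n) + ?c" by (simp add: algebra_simps)
  \<comment> \<open>The source term is enlarged by a power of \<open>?C\<close>, which is at least
    1, so that it merges with the induction bound as one more multiple of \<open>?c\<close>.\<close>
  also have "\<dots> \<le> ?C * (?C ^ n * (W1 (empirical N ys) (\<mu>s t) + n * ?c)) + ?C ^ Suc n * ?c"
  proof (intro add_mono mult_left_mono)
    have D1: "1 \<le> ?D" by simp
    have "1 \<le> ?C" using mult_mono[of 1 ?D 1 "1 + 2 * \<beta>"] \<beta> D1 by simp
    then have "1 \<le> ?C ^ Suc n" by (rule one_le_power)
    then have "1 * ?c \<le> ?C ^ Suc n * ?c" by (intro mult_right_mono) auto
    then show "?c \<le> ?C ^ Suc n * ?c" by simp
    show "?e n + ?d n \<le> ?C ^ n * (W1 (empirical N ys) (\<mu>s t) + n * ?c)" using Suc by simp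
    show "0 \<le> ?C" using \<beta> by simp
  qed
  also have "\<dots> = ?C ^ Suc n * (W1 (empirical N ys) (\<mu>s t) + Suc n * ?c)"
  proof -
    have "C * (x * (w + m * c)) + C * x * c = C * x * (w + (1 + m) * c)" for C x w m c :: real
      by (simp add: algebra_simps)
    then show ?thesis unfolding power_Suc of_nat_Suc .
  qed
  finally show ?case .
qed

section \<open>Payoffs through marginals, norms and limits of sets\<close>

text \<open>Linearity, as the cost is additive in time. The bound on \<open>g\<close> is asked only
  before \<open>T\<close> because controls are constrained to \<open>A\<close> only at times up to
  \<open>T\<close>.\<close>

lemma expectation_path_law:
  assumes h: "\<And>x. \<bar>h x\<bar> \<le> B" and g: "\<And>s x. s < T \<Longrightarrow> \<bar>g s x\<bar> \<le> B" and t: "t \<le> T"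
  shows "E (path_law K t m (T - t)) (\<lambda>w. h (w T) + (\<Sum>s\<in>{t..<T}. g s (w s)))
    = E (marginal K t m (T - t)) h + (\<Sum>s\<in>{t..<T}. E (marginal K t m (s - t)) (g s))"
proof -
  let ?P = "path_law K t m (T - t)"
  have 1: "integrable (measure_pmf ?P) (\<lambda>w. h (w T))"
    by (rule integrable_pmf_bounded, rule h)
  have 2: "integrable (measure_pmf ?P) (\<lambda>w. g s (w s))" if "s \<in> {t..<T}" for s
    by (rule integrable_pmf_bounded, rule g) (use that in simp)
  have m: "E (marginal K t m (s - t)) f = E ?P (\<lambda>w. f (w s))" if "t \<le> s" "s \<le> T" for s f
  proof -
    have eq: "map_pmf (\<lambda>w. w s) ?P = marginal K t m (s - t)"
      by (rule path_law_marginal) (use that t in auto)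
    show ?thesis unfolding eq[symmetric] by simp
  qed
  have "E ?P (\<lambda>w. h (w T) + (\<Sum>s\<in>{t..<T}. g s (w s)))
      = E ?P (\<lambda>w. h (w T)) + (\<Sum>s\<in>{t..<T}. E ?P (\<lambda>w. g s (w s)))"
  proof -
    have "integrable (measure_pmf ?P) (\<lambda>w. \<Sum>s\<in>{t..<T}. g s (w s))"
      by (rule Bochner_Integration.integrable_sum) (rule 2)
    then have "E ?P (\<lambda>w. h (w T) + (\<Sum>s\<in>{t..<T}. g s (w s)))
        = E ?P (\<lambda>w. h (w T)) + E ?P (\<lambda>w. \<Sum>s\<in>{t..<T}. g s (w s))"
      by (rule Bochner_Integration.integral_add[OF 1])
    also have "E ?P (\<lambda>w. \<Sum>s\<in>{t..<T}. g s (w s)) = (\<Sum>s\<in>{t..<T}. E ?P (\<lambda>w. g s (w s)))"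
      by (rule Bochner_Integration.integral_sum) (rule 2)
    finally show ?thesis .
  qed
  then show ?thesis using t by (simp add: m)
qed

lemma abs_payoff_le:
  fixes h B :: real and g :: "nat \<Rightarrow> real"
  assumes "\<bar>h\<bar> \<le> B" and "\<And>s. s < T \<Longrightarrow> \<bar>g s\<bar> \<le> B"
  shows "\<bar>h + (\<Sum>s\<in>{t..<T}. g s)\<bar> \<le> (real T + 1) * B"
proof -
  have B: "0 \<le> B" using assms(1) by linarith
  have "\<bar>\<Sum>s\<in>{t..<T}. g s\<bar> \<le> (\<Sum>s\<in>{t..<T}. B)"
    by (rule order_trans[OF sum_abs sum_mono]) (use assms(2) in auto)
  also have "\<dots> \<le> T * B" using B by (simp add: mult_right_mono)
  finally show ?thesis using assms(1) by (simp add: algebra_simps)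
qed

lemma sup_norm_le_iff: "sup_norm f \<le> c \<longleftrightarrow> (\<forall>x. \<bar>f x\<bar> \<le> c)"
  by (simp add: sup_norm_def)

lemma set_liminf_subset_set_limsup: "set_liminf X \<subseteq> set_limsup X"
proof
  fix x assume "x \<in> set_liminf X"
  then obtain n where n: "\<And>N. N \<ge> n \<Longrightarrow> x \<in> X N" by (auto simp: set_liminf_def)
  show "x \<in> set_limsup X"
    unfolding set_limsup_def
  proof
    fix m
    show "x \<in> (\<Union>N\<in>{m..}. X N)" using n[of "max n m"] by (intro UN_I[of "max n m"]) auto
  qed
qed

text \<open>Full support means that some player occupies each state, so conditions on all players
  become conditions on all states.\<close>

lemma S0_surj:
  assumes "xs \<in> S0 N" "N > 0"
  obtains i where "i \<in> {1..N}" "xs i = x"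
proof -
  have "xs ` {1..N} = UNIV" using assms by (auto simp: S0_def P0_def empirical_def)
  then show ?thesis using that by (metis UNIV_I imageE)
qed

section \<open>The game under the regularity hypotheses\<close>

locale regular_mean_field_game = mean_field_game T A q F G
  for T :: nat
    and A :: "'a::euclidean_space set"
    and q :: "nat \<Rightarrow> 's::finite \<Rightarrow> 's pmf \<Rightarrow> 'a \<Rightarrow> 's pmf"
    and F :: "nat \<Rightarrow> 's \<Rightarrow> 's pmf \<Rightarrow> 'a \<Rightarrow> real"
    and G :: "'s \<Rightarrow> 's pmf \<Rightarrow> real" +
  fixes Lq C0 :: real and \<rho> :: "real \<Rightarrow> real"
  assumes q_Lipschitz: "\<And>s x y \<mu> \<nu> a b. s \<le> T \<Longrightarrow> a \<in> A \<Longrightarrow> b \<in> A \<Longrightarrow>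
      \<bar>pmf (q s x \<mu> a) y - pmf (q s x \<nu> b) y\<bar> \<le> Lq * (W1 \<mu> \<nu> + norm (a - b))"
    and F_bounded: "\<And>s x \<mu> a. s \<le> T \<Longrightarrow> a \<in> A \<Longrightarrow> \<bar>F s x \<mu> a\<bar> \<le> C0"
    and G_bounded: "\<And>x \<mu>. \<bar>G x \<mu>\<bar> \<le> C0"
    and \<rho>: "modulus_of_continuity \<rho>"
    and F_continuous: "\<And>s x \<mu> \<nu> a b. s \<le> T \<Longrightarrow> a \<in> A \<Longrightarrow> b \<in> A \<Longrightarrow>
      \<bar>F s x \<mu> a - F s x \<nu> b\<bar> \<le> \<rho> (W1 \<mu> \<nu> + norm (a - b))"
    and G_continuous: "\<And>x \<mu> \<nu>. \<bar>G x \<mu> - G x \<nu>\<bar> \<le> \<rho> (W1 \<mu> \<nu>)"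
begin

lemma C0_nonneg: "0 \<le> C0"
  using G_bounded by (meson abs_ge_zero order_trans)

text \<open>The costs being bounded, their modulus of continuity can be replaced by an affine one, for which
  the expected distance of the empirical measure to the flow suffices.\<close>

lemma cost_affine_modulus:
  assumes "\<eta> > 0"
  obtains K where "K \<ge> 0"
    and "\<And>s x \<mu> \<nu> a b. s \<le> T \<Longrightarrow> a \<in> A \<Longrightarrow> b \<in> A \<Longrightarrow>
      \<bar>F s x \<mu> a - F s x \<nu> b\<bar> \<le> \<eta> + K * (W1 \<mu> \<nu> + norm (a - b))"
    and "\<And>x \<mu> \<nu>. \<bar>G x \<mu> - G x \<nu>\<bar> \<le> \<eta> + K * W1 \<mu> \<nu>"
proof -
  have "\<forall>\<^sub>F r in at_right 0. \<rho> r < \<eta>"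
    using \<rho> assms unfolding modulus_of_continuity_def by (auto elim!: order_tendstoD)
  then obtain \<delta> where \<delta>: "\<delta> > 0" "\<And>r. 0 < r \<Longrightarrow> r < \<delta> \<Longrightarrow> \<rho> r < \<eta>"
    by (auto simp: eventually_at_right_field)
  \<comment> \<open>With this slope the affine bound reaches \<open>2 * C0\<close>, the largest
    possible cost difference, from distance \<open>\<delta>\<close> on.\<close>
  let ?K = "2 * C0 / \<delta>"
  have K: "?K \<ge> 0" using C0_nonneg \<delta>(1) by simp
  have *: "u \<le> \<eta> + ?K * r" if "u \<le> \<rho> r" "u \<le> 2 * C0" "0 \<le> r" for u r
  proof (cases "r < \<delta>")
    case True
    \<comment> \<open>The limit at 0 controls positive \<open>r\<close> only; the case
      \<open>r = 0\<close> uses \<open>\<rho> 0 = 0\<close>.\<close>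
    have "\<rho> r \<le> \<eta>"
      using \<rho> assms \<delta>(2)[of r] True that(3) unfolding modulus_of_continuity_def by (cases "r = 0") auto
    moreover have "0 \<le> ?K * r" using K that(3) by (intro mult_nonneg_nonneg)
    ultimately show ?thesis using that(1) by linarith
  next
    case False
    then have "?K * \<delta> \<le> ?K * r" using K by (intro mult_left_mono) auto
    then show ?thesis using that(2) assms \<delta>(1) by simp
  qed
  show ?thesis
  proof (rule that[OF K])
    show "\<bar>F s x \<mu> a - F s x \<nu> b\<bar> \<le> \<eta> + ?K * (W1 \<mu> \<nu> + norm (a - b))"
      if "s \<le> T" "a \<in> A" "b \<in> A" for s x \<mu> \<nu> a b
      using F_continuous[OF that] F_bounded[OF that(1,2), of x \<mu>] F_bounded[OF that(1,3), of x \<nu>]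
      by (intro *) (auto simp: W1_nonneg)
    show "\<bar>G x \<mu> - G x \<nu>\<bar> \<le> \<eta> + ?K * W1 \<mu> \<nu>" for x \<mu> \<nu>
      using G_continuous[of x \<mu> \<nu>] G_bounded[of x \<mu>] G_bounded[of x \<nu>]
      by (intro *) (auto simp: W1_nonneg)
  qed
qed

lemma A_state_LipD:
  assumes "\<alpha> \<in> A_state_Lip L" "s \<le> T"
  shows "\<alpha> s x \<mu> \<in> A" "norm (\<alpha> s x \<mu> - \<alpha> s x \<nu>) \<le> L * W1 \<mu> \<nu>"
  using assms by (auto simp: A_state_Lip_def)

text \<open>Makes every mean field deviation available to the players at each Lipschitz
  level.\<close>

lemma A_state_Lip_const: "a \<in> A_state \<Longrightarrow> 0 \<le> L \<Longrightarrow> (\<lambda>s x _. a s x) \<in> A_state_Lip L"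
  by (auto simp: A_state_Lip_def A_state_def W1_nonneg)

lemma feedback_kernel_Lipschitz:
  assumes "\<alpha> \<in> A_state_Lip L" "s \<le> T" "0 \<le> L"
  shows "\<bar>pmf (q s x \<mu> (\<alpha> s x \<mu>)) z - pmf (q s x \<nu> (\<alpha> s x \<nu>)) z\<bar> \<le> \<bar>Lq\<bar> * (1 + L) * W1 \<mu> \<nu>"
proof -
  note \<alpha> = A_state_LipD[OF assms(1,2)]
  have "\<bar>pmf (q s x \<mu> (\<alpha> s x \<mu>)) z - pmf (q s x \<nu> (\<alpha> s x \<nu>)) z\<bar> \<le> Lq * (W1 \<mu> \<nu> + norm (\<alpha> s x \<mu> - \<alpha> s x \<nu>))"
    by (rule q_Lipschitz[OF assms(2) \<alpha>(1) \<alpha>(1)])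
  \<comment> \<open>\<open>Lq\<close> carries no sign assumption, hence the absolute value.\<close>
  also have "\<dots> \<le> \<bar>Lq\<bar> * (W1 \<mu> \<nu> + norm (\<alpha> s x \<mu> - \<alpha> s x \<nu>))"
    by (intro mult_right_mono) (auto simp: W1_nonneg)
  also have "\<dots> \<le> \<bar>Lq\<bar> * (W1 \<mu> \<nu> + L * W1 \<mu> \<nu>)"
    by (intro mult_left_mono add_left_mono \<alpha>(2)) auto
  finally show ?thesis by (simp add: algebra_simps)
qed

section \<open>Feedback controls and their flows\<close>

text \<open>The closed-loop flow: control and kernel both see the current law. Before
  \<open>t\<close>, truncated subtraction makes it constantly \<open>\<mu>\<close>.\<close>

definition feedback_flow :: "nat \<Rightarrow> 's pmf \<Rightarrow> (nat \<Rightarrow> 's \<Rightarrow> 's pmf \<Rightarrow> 'a) \<Rightarrow> nat \<Rightarrow> 's pmf" where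
  "feedback_flow t \<mu> \<alpha> s = marginal (\<lambda>r m x. q r x m (\<alpha> r x m)) t \<mu> (s - t)"

definition along :: "(nat \<Rightarrow> 's pmf) \<Rightarrow> (nat \<Rightarrow> 's \<Rightarrow> 's pmf \<Rightarrow> 'a) \<Rightarrow> nat \<Rightarrow> 's \<Rightarrow> 'a" where
  "along \<mu>s \<alpha> s x = \<alpha> s x (\<mu>s s)"

lemma along_const [simp]: "along \<mu>s (\<lambda>s x _. a s x) = a"
  by (simp add: fun_eq_iff along_def)

lemma along_A_state: "\<alpha> \<in> A_state_Lip L \<Longrightarrow> along \<mu>s \<alpha> \<in> A_state"
  by (auto simp: A_state_Lip_def A_state_def along_def)

lemma feedback_flow_initial [simp]: "feedback_flow t \<mu> \<alpha> t = \<mu>"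
  by (simp add: feedback_flow_def)

lemma feedback_flow_Suc:
  "t \<le> s \<Longrightarrow> feedback_flow t \<mu> \<alpha> (Suc s) =
    bind_pmf (feedback_flow t \<mu> \<alpha> s) (\<lambda>x. q s x (feedback_flow t \<mu> \<alpha> s) (\<alpha> s x (feedback_flow t \<mu> \<alpha> s)))"
  by (simp add: feedback_flow_def Suc_diff_le)

lemma mf_flow_along:
  assumes "t \<le> s" "s \<le> T"
  shows "mf_flow t \<mu> (along (feedback_flow t \<mu> \<alpha>) \<alpha>) s = feedback_flow t \<mu> \<alpha> s"
proof -
  let ?a = "along (feedback_flow t \<mu> \<alpha>) \<alpha>"
  have "marginal (\<lambda>r m x. q r x m (?a r x)) t \<mu> n = marginal (\<lambda>r m x. q r x m (\<alpha> r x m)) t \<mu> n" for n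
    by (induction n) (simp_all add: along_def feedback_flow_def)
  then show ?thesis
    using assms by (simp add: mf_flow_def feedback_flow_def path_law_marginal)
qed

section \<open>Payoffs of the two games and their distance\<close>

text \<open>Needed because \<open>mf_flow_along\<close> identifies the two flows only between
  \<open>t\<close> and \<open>T\<close>.\<close>

lemma J_flow_cong:
  assumes \<mu>s: "\<And>s. t \<le> s \<Longrightarrow> s \<le> T \<Longrightarrow> \<mu>s s = \<mu>s' s" and t: "t \<le> T"
  shows "J_flow \<mu>s t x a = J_flow \<mu>s' t x a"
proof -
  have "path_law (\<lambda>r _ y. q r y (\<mu>s r) (a r y)) t m n = path_law (\<lambda>r _ y. q r y (\<mu>s' r) (a r y)) t m n"
    if "n \<le> T - t" for m n
    using that t by (induction n) (auto simp: \<mu>s Let_def intro!: bind_pmf_cong)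
  then show ?thesis
    using t by (simp add: J_flow_def tagged_law_def \<mu>s)
qed

lemma J_flow_marginal:
  assumes a: "a \<in> A_state" and t: "t \<le> T"
  shows "J_flow \<mu>s t x a = E (marginal (\<lambda>s _ y. q s y (\<mu>s s) (a s y)) t (return_pmf x) (T - t)) (\<lambda>y. G y (\<mu>s T))
    + (\<Sum>s\<in>{t..<T}. E (marginal (\<lambda>s _ y. q s y (\<mu>s s) (a s y)) t (return_pmf x) (s - t)) (\<lambda>y. F s y (\<mu>s s) (a s y)))"
  unfolding J_flow_def tagged_law_def
  by (rule expectation_path_law[where B = C0]) (use a t in \<open>auto simp: A_state_def intro!: G_bounded F_bounded\<close>)

text \<open>Brings the payoff into the form to which \<open>propagation_of_chaos\<close>
  applies.\<close>

lemma J_player_marginal: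
  fixes N i t :: nat and ys :: "nat \<Rightarrow> 's" and \<alpha> \<alpha>' :: "nat \<Rightarrow> 's \<Rightarrow> 's pmf \<Rightarrow> 'a"
  assumes \<alpha>': "\<alpha>' \<in> A_state_Lip L" and t: "t \<le> T"
  defines "Y \<equiv> marginal (\<lambda>s _. player_kernel N i (\<lambda>s x \<nu>. q s x \<nu> (\<alpha> s x \<nu>)) (\<lambda>s x \<nu>. q s x \<nu> (\<alpha>' s x \<nu>)) s) t (return_pmf ys)"
  shows "J_player N i t ys ((\<lambda>_. \<alpha>)(i := \<alpha>')) = E (Y (T - t)) (\<lambda>y. G (y i) (empirical N y))
    + (\<Sum>s\<in>{t..<T}. E (Y (s - t)) (\<lambda>y. F s (y i) (empirical N y) (\<alpha>' s (y i) (empirical N y))))"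
proof -
  have k: "(\<lambda>s (_ :: (nat \<Rightarrow> 's) pmf) ys. Pi_pmf {1..N} undefined
                 (\<lambda>j. q s (ys j) (empirical N ys) (((\<lambda>_. \<alpha>)(i := \<alpha>')) j s (ys j) (empirical N ys))))
     = (\<lambda>s _. player_kernel N i (\<lambda>s x \<nu>. q s x \<nu> (\<alpha> s x \<nu>)) (\<lambda>s x \<nu>. q s x \<nu> (\<alpha>' s x \<nu>)) s)"
    by (intro ext) (auto simp: player_kernel_def intro!: arg_cong[where f = "Pi_pmf _ _"])
  show ?thesis
    unfolding J_player_def players_law_def k Y_def fun_upd_same
    by (rule expectation_path_law[where B = C0])
      (use A_state_LipD[OF \<alpha>'] t in \<open>auto intro!: G_bounded F_bounded\<close>)
qed

lemma abs_J_flow_le: "a \<in> A_state \<Longrightarrow> \<bar>J_flow \<mu>s t x a\<bar> \<le> (real T + 1) * C0"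
  unfolding J_flow_def
  by (rule abs_expectation_le, rule abs_payoff_le, rule G_bounded, rule F_bounded) (auto simp: A_state_def)

lemma abs_J_player_le:
  "\<alpha>s i \<in> A_state_Lip L \<Longrightarrow> \<bar>J_player N i t ys \<alpha>s\<bar> \<le> (real T + 1) * C0"
  unfolding J_player_def
  by (rule abs_expectation_le, rule abs_payoff_le, rule G_bounded, rule F_bounded) (auto simp: A_state_Lip_def)

text \<open>A real infimum is a lower bound only for a family bounded below; the uniform payoff
  bound provides this, here and for \<open>v_N\<close>.\<close>

lemma v_le: "a \<in> A_state \<Longrightarrow> v \<mu>s t x \<le> J_flow \<mu>s t x a"
  unfolding v_def using abs_J_flow_le[of _ \<mu>s t x]
  by (intro cINF_lower bdd_belowI2[where m = "- ((real T + 1) * C0)"]) (auto simp: abs_le_iff minus_le_iff)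

lemma v_N_le: "\<alpha>' \<in> A_state_Lip L \<Longrightarrow> v_N N L i t ys \<alpha> \<le> J_player N i t ys ((\<lambda>_. \<alpha>)(i := \<alpha>'))"
  unfolding v_N_def using abs_J_player_le[of "(\<lambda>_. \<alpha>)(i := _)" i L N t ys]
  by (intro cINF_lower bdd_belowI2[where m = "- ((real T + 1) * C0)"]) (auto simp: abs_le_iff minus_le_iff)

text \<open>Each cost term is compared by \<open>coupled_expectation_le\<close>. The weight
  \<open>K * (1 + L)\<close> arises because the measure enters the running cost directly and through
  the control; \<open>C0\<close> weighs the error in the player's law. The bound depends on the
  controls only through \<open>L\<close>.\<close>

lemma J_player_close:
  fixes N i t :: nat and ys :: "nat \<Rightarrow> 's" and \<alpha> \<alpha>' :: "nat \<Rightarrow> 's \<Rightarrow> 's pmf \<Rightarrow> 'a"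
    and \<mu> :: "'s pmf" and L K \<eta> :: real
  assumes \<alpha>: "\<alpha> \<in> A_state_Lip L" and \<alpha>': "\<alpha>' \<in> A_state_Lip L" and L: "0 \<le> L" and t: "t \<le> T"
    and N: "N > 0" and i: "i \<in> {1..N}" and K: "0 \<le> K" and \<eta>: "0 \<le> \<eta>"
    and F_mod: "\<And>s x \<mu> \<nu> a b. s \<le> T \<Longrightarrow> a \<in> A \<Longrightarrow> b \<in> A \<Longrightarrow>
      \<bar>F s x \<mu> a - F s x \<nu> b\<bar> \<le> \<eta> + K * (W1 \<mu> \<nu> + norm (a - b))"
    and G_mod: "\<And>x \<mu> \<nu>. \<bar>G x \<mu> - G x \<nu>\<bar> \<le> \<eta> + K * W1 \<mu> \<nu>"
  defines "\<mu>s \<equiv> feedback_flow t \<mu> \<alpha>"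
    and "S \<equiv> (CARD('s) * (1 + 2 * (\<bar>Lq\<bar> * (1 + L)))) ^ T * (W1 (empirical N ys) \<mu> + T * (2 * real CARD('s) / sqrt N))"
  shows "\<bar>J_player N i t ys ((\<lambda>_. \<alpha>)(i := \<alpha>')) - J t \<mu> (along \<mu>s \<alpha>) (ys i) (along \<mu>s \<alpha>')\<bar>
    \<le> (T + 1) * (\<eta> + (K * (1 + L) + C0) * S)"
proof -
  let ?\<beta> = "\<bar>Lq\<bar> * (1 + L)"
  let ?Q = "\<lambda>s x \<nu>. q s x \<nu> (\<alpha> s x \<nu>)" and ?R = "\<lambda>s x \<nu>. q s x \<nu> (\<alpha>' s x \<nu>)"
  define Y where "Y = marginal (\<lambda>s _. player_kernel N i ?Q ?R s) t (return_pmf ys)"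
  define p where "p = marginal (\<lambda>s _ y. q s y (\<mu>s s) (along \<mu>s \<alpha>' s y)) t (return_pmf (ys i))"
  let ?e = "\<lambda>n. E (Y n) (\<lambda>y. W1 (empirical N y) (\<mu>s (t + n)))"
  let ?d = "\<lambda>n. W1 (map_pmf (\<lambda>y. y i) (Y n)) (p n)"
  let ?C = "CARD('s) * (1 + 2 * ?\<beta>)" and ?c = "2 * real CARD('s) / sqrt N"
  have \<beta>: "0 \<le> ?\<beta>" using L by simp
  have C: "1 \<le> ?C"
    using mult_mono[of 1 "real CARD('s)" 1 "1 + 2 * ?\<beta>"] \<beta> by simp
  have S: "?e n + ?d n \<le> S" if "t + n \<le> T" for n
  proof -
    have "?e n + ?d n \<le> ?C ^ n * (W1 (empirical N ys) (\<mu>s t) + n * ?c)"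
      unfolding Y_def p_def along_def
      by (rule propagation_of_chaos[OF N i \<beta>, where T = T])
        (use that L in \<open>auto intro!: feedback_kernel_Lipschitz \<alpha> \<alpha>' simp: \<mu>s_def feedback_flow_Suc\<close>)
    \<comment> \<open>The exponent and the factor \<open>n\<close> are raised to \<open>T\<close>,
      which the base \<open>?C\<close>, at least 1, permits.\<close>
    also have "\<dots> \<le> S"
      unfolding S_def using C that
      by (intro mult_mono add_mono power_increasing mult_right_mono)
        (auto simp: \<mu>s_def W1_nonneg intro!: add_nonneg_nonneg)
    finally show ?thesis .
  qed
  have cost: "\<bar>E (Y n) H - E (p n) h\<bar> \<le> \<eta> + (K * (1 + L) + C0) * S"
    if n: "t + n \<le> T" and h: "\<And>x. \<bar>h x\<bar> \<le> C0" and H: "\<And>y. \<bar>H y\<bar> \<le> C0"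
      and Hh: "\<And>y. \<bar>H y - h (y i)\<bar> \<le> \<eta> + K * (1 + L) * W1 (empirical N y) (\<mu>s (t + n))" for n H h
  proof -
    have nn: "0 \<le> ?e n" "0 \<le> ?d n"
      by (auto intro!: Bochner_Integration.integral_nonneg W1_nonneg)
    have "\<bar>E (Y n) H - E (p n) h\<bar> \<le> \<eta> + K * (1 + L) * ?e n + C0 * ?d n"
      by (rule coupled_expectation_le[OF h H Hh])
    also have "\<dots> \<le> \<eta> + K * (1 + L) * S + C0 * S"
      using nn S[OF n] K L C0_nonneg by (intro add_mono mult_left_mono) auto
    finally show ?thesis by (simp add: algebra_simps)
  qed
  have along: "along \<mu>s \<alpha>' \<in> A_state" using \<alpha>' by (rule along_A_state)
  have J: "J t \<mu> (along \<mu>s \<alpha>) (ys i) (along \<mu>s \<alpha>') = J_flow \<mu>s t (ys i) (along \<mu>s \<alpha>')"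
    unfolding J_def by (rule J_flow_cong) (use t in \<open>simp_all add: \<mu>s_def mf_flow_along\<close>)
  let ?Fd = "\<lambda>s. E (Y (s - t)) (\<lambda>y. F s (y i) (empirical N y) (\<alpha>' s (y i) (empirical N y)))
      - E (p (s - t)) (\<lambda>y. F s y (\<mu>s s) (along \<mu>s \<alpha>' s y))"
  have "J_player N i t ys ((\<lambda>_. \<alpha>)(i := \<alpha>')) - J t \<mu> (along \<mu>s \<alpha>) (ys i) (along \<mu>s \<alpha>')
    = (E (Y (T - t)) (\<lambda>y. G (y i) (empirical N y)) - E (p (T - t)) (\<lambda>y. G y (\<mu>s T)))
      + (\<Sum>s\<in>{t..<T}. ?Fd s)"
    unfolding J J_player_marginal[OF \<alpha>' t] J_flow_marginal[OF along t] Y_def p_def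
    by (simp add: sum_subtractf)
  also have "\<bar>\<dots>\<bar> \<le> (\<eta> + (K * (1 + L) + C0) * S) + (\<Sum>s\<in>{t..<T}. \<eta> + (K * (1 + L) + C0) * S)"
  proof (intro order_trans[OF abs_triangle_ineq] add_mono order_trans[OF sum_abs] sum_mono)
    \<comment> \<open>The terminal cost involves no control; its weight is relaxed so that one bound
      covers all terms.\<close>
    have "\<eta> + K * W1 \<mu>' \<nu> \<le> \<eta> + K * (1 + L) * W1 \<mu>' \<nu>" for \<mu>' \<nu> :: "'s pmf"
      using K L by (intro add_left_mono mult_right_mono W1_nonneg) (simp add: mult_le_cancel_left1)
    then show "\<bar>E (Y (T - t)) (\<lambda>y. G (y i) (empirical N y)) - E (p (T - t)) (\<lambda>y. G y (\<mu>s T))\<bar>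
      \<le> \<eta> + (K * (1 + L) + C0) * S"
      using t by (intro cost G_bounded) (auto intro: order_trans[OF G_mod])
    fix s assume s: "s \<in> {t..<T}"
    then have sT: "s \<le> T" by simp
    show "\<bar>?Fd s\<bar> \<le> \<eta> + (K * (1 + L) + C0) * S"
    proof (intro cost F_bounded sT)
      show "t + (s - t) \<le> T" using s by simp
      fix y
      note \<alpha>'D = A_state_LipD[OF \<alpha>' sT]
      show "\<alpha>' s (y i) (empirical N y) \<in> A" by (rule \<alpha>'D)
      let ?\<nu> = "empirical N y"
      have "\<bar>F s (y i) ?\<nu> (\<alpha>' s (y i) ?\<nu>) - F s (y i) (\<mu>s s) (along \<mu>s \<alpha>' s (y i))\<bar>
        \<le> \<eta> + K * (W1 ?\<nu> (\<mu>s s) + norm (\<alpha>' s (y i) ?\<nu> - \<alpha>' s (y i) (\<mu>s s)))"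
        unfolding along_def by (intro F_mod sT \<alpha>'D)
      also have "\<dots> \<le> \<eta> + K * (W1 ?\<nu> (\<mu>s s) + L * W1 ?\<nu> (\<mu>s s))"
        by (intro add_left_mono mult_left_mono \<alpha>'D K)
      finally show "\<bar>F s (y i) ?\<nu> (\<alpha>' s (y i) ?\<nu>) - F s (y i) (\<mu>s s) (along \<mu>s \<alpha>' s (y i))\<bar>
        \<le> \<eta> + K * (1 + L) * W1 ?\<nu> (\<mu>s (t + (s - t)))"
        using s by (simp add: algebra_simps)
    next
      show "along \<mu>s \<alpha>' s x \<in> A" for x using along sT by (simp add: A_state_def)
    qed
  qed
  also have "\<dots> \<le> (T + 1) * (\<eta> + (K * (1 + L) + C0) * S)"
  proof -
    have "0 \<le> S" unfolding S_def using C by (intro mult_nonneg_nonneg add_nonneg_nonneg) (auto simp: W1_nonneg)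
    then have "0 \<le> \<eta> + (K * (1 + L) + C0) * S" using \<eta> K L C0_nonneg by simp
    then have "(T - t) * (\<eta> + (K * (1 + L) + C0) * S) \<le> T * (\<eta> + (K * (1 + L) + C0) * S)"
      by (intro mult_right_mono) auto
    then show ?thesis by (simp add: distrib_right)
  qed
  finally show ?thesis .
qed

section \<open>Transfer of approximate equilibria and passage to the limit\<close>

context
  fixes t :: nat and \<mu> :: "'s pmf" and xs :: "nat \<Rightarrow> nat \<Rightarrow> 's"
  assumes t: "t \<le> T"
    and xs: "\<And>N. CARD('s) \<le> N \<Longrightarrow> xs N \<in> S0 N"
    and xs_lim: "(\<lambda>N. W1 (empirical N (xs N)) \<mu>) \<longlonglongrightarrow> 0"
begin

text \<open>The order of choices matters: \<open>\<eta>\<close> first, which fixes \<open>K\<close>,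
  and then \<open>N\<close> so large that the remaining error is small. The threshold precedes the
  controls, so closeness is uniform in them.\<close>

lemma eventually_J_player_close:
  assumes L: "0 \<le> L" and \<delta>: "0 < \<delta>"
  shows "\<forall>\<^sub>F N in sequentially. \<forall>\<alpha>\<in>A_state_Lip L. \<forall>\<alpha>'\<in>A_state_Lip L. \<forall>i\<in>{1..N}.
    \<bar>J_player N i t (xs N) ((\<lambda>_. \<alpha>)(i := \<alpha>')) -
      J t \<mu> (along (feedback_flow t \<mu> \<alpha>) \<alpha>) (xs N i) (along (feedback_flow t \<mu> \<alpha>) \<alpha>')\<bar> \<le> \<delta>"
proof -
  \<comment> \<open>The modulus error, summed over at most \<open>T + 1\<close> cost terms, takes
    half of \<open>\<delta>\<close>.\<close>
  define \<eta> where "\<eta> = \<delta> / (2 * (T + 1))"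
  have \<eta>: "\<eta> > 0" using \<delta> by (simp add: \<eta>_def)
  obtain K where K: "K \<ge> 0"
    and F_mod: "\<And>s x \<mu> \<nu> a b. s \<le> T \<Longrightarrow> a \<in> A \<Longrightarrow> b \<in> A \<Longrightarrow>
      \<bar>F s x \<mu> a - F s x \<nu> b\<bar> \<le> \<eta> + K * (W1 \<mu> \<nu> + norm (a - b))"
    and G_mod: "\<And>x \<mu> \<nu>. \<bar>G x \<mu> - G x \<nu>\<bar> \<le> \<eta> + K * W1 \<mu> \<nu>"
    using cost_affine_modulus[OF \<eta>] by blast
  let ?S = "\<lambda>N. (CARD('s) * (1 + 2 * (\<bar>Lq\<bar> * (1 + L)))) ^ T
    * (W1 (empirical N (xs N)) \<mu> + T * (2 * real CARD('s) / sqrt N))"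
  have "(\<lambda>N::nat. 1 / sqrt N) \<longlonglongrightarrow> 0" by real_asymp
  then have "(\<lambda>N::nat. T * (2 * real CARD('s) / sqrt N)) \<longlonglongrightarrow> 0"
    using tendsto_mult_right_zero[of "\<lambda>N::nat. 1 / sqrt N" sequentially "T * (2 * CARD('s))"] by simp
  then have "(\<lambda>N. (T + 1) * (\<eta> + (K * (1 + L) + C0) * ?S N)) \<longlonglongrightarrow> (T + 1) * (\<eta> + (K * (1 + L) + C0) * 
     ((CARD('s) * (1 + 2 * (\<bar>Lq\<bar> * (1 + L)))) ^ T * (0 + 0)))"
    using xs_lim by (intro tendsto_intros)
  moreover have "(T + 1) * \<eta> < \<delta>"
  proof -
    have "(T + 1) * \<eta> = \<delta> / 2" by (simp add: \<eta>_def field_simps)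
    then show ?thesis using \<delta> by simp
  qed
  ultimately have "\<forall>\<^sub>F N in sequentially. (T + 1) * (\<eta> + (K * (1 + L) + C0) * ?S N) < \<delta>"
    by (intro order_tendstoD) simp_all
  then show ?thesis
  proof (eventually_elim, intro ballI)
    fix N \<alpha> \<alpha>' i
    assume "(T + 1) * (\<eta> + (K * (1 + L) + C0) * ?S N) < \<delta>"
      and "\<alpha> \<in> A_state_Lip L" "\<alpha>' \<in> A_state_Lip L" "i \<in> {1..N}"
    with J_player_close[of \<alpha> L \<alpha>' t N i K \<eta> "xs N" \<mu>] L t K \<eta> F_mod G_mod
    show "\<bar>J_player N i t (xs N) ((\<lambda>_. \<alpha>)(i := \<alpha>')) -
      J t \<mu> (along (feedback_flow t \<mu> \<alpha>) \<alpha>) (xs N i) (along (feedback_flow t \<mu> \<alpha>) \<alpha>')\<bar> \<le> \<delta>"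
      by fastforce
  qed
qed

text \<open>The player equilibrium frozen along its flow is the mean field candidate. Closeness is
  used twice, at the equilibrium and at the deviation, hence \<open>2 * \<delta>\<close>.\<close>

lemma eventually_V_N_subset:
  assumes L: "0 \<le> L" and \<delta>: "0 < \<delta>"
  shows "\<forall>\<^sub>F N in sequentially. V_N N \<epsilon> L t (empirical N (xs N)) \<subseteq> V_state_eps (\<epsilon> + 2 * \<delta>) t \<mu>"
  using eventually_J_player_close[OF L \<delta>] eventually_ge_at_top[of "CARD('s)"]
proof (eventually_elim, intro subsetI)
  fix N \<phi>
  assume close: "\<forall>\<alpha>\<in>A_state_Lip L. \<forall>\<alpha>'\<in>A_state_Lip L. \<forall>i\<in>{1..N}.
      \<bar>J_player N i t (xs N) ((\<lambda>_. \<alpha>)(i := \<alpha>')) -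
        J t \<mu> (along (feedback_flow t \<mu> \<alpha>) \<alpha>) (xs N i) (along (feedback_flow t \<mu> \<alpha>) \<alpha>')\<bar> \<le> \<delta>"
    and N: "CARD('s) \<le> N" and \<phi>: "\<phi> \<in> V_N N \<epsilon> L t (empirical N (xs N))"
  \<comment> \<open>Fewer than \<open>CARD('s)\<close> players cannot occupy all states, so
    \<open>S0 N\<close> is available only from there on.\<close>
  have S0: "xs N \<in> S0 N" using N by (rule xs)
  have N0: "N > 0" using N by (metis zero_less_card_finite order_less_le_trans)
  obtain \<alpha> where \<alpha>M: "\<alpha> \<in> M_N_at N \<epsilon> L t (xs N)"
    and \<phi>J: "\<And>x. \<bar>\<phi> x - J_N N t x (empirical N (xs N)) \<alpha>\<bar> \<le> \<epsilon>"
    using \<phi> by (auto simp: V_N_def M_N_eq[OF S0] sup_norm_le_iff)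
  then have \<alpha>: "\<alpha> \<in> A_state_Lip L"
    and opt: "\<And>i. i \<in> {1..N} \<Longrightarrow> J_player N i t (xs N) (\<lambda>_. \<alpha>) \<le> v_N N L i t (xs N) \<alpha> + \<epsilon>"
    by (auto simp: M_N_at_def)
  let ?\<mu>s = "feedback_flow t \<mu> \<alpha>"
  let ?a = "along ?\<mu>s \<alpha>"
  have self: "\<bar>J_player N i t (xs N) (\<lambda>_. \<alpha>) - J t \<mu> ?a (xs N i) ?a\<bar> \<le> \<delta>" if "i \<in> {1..N}" for i
    using close[rule_format, OF \<alpha> \<alpha> that] by (simp add: fun_upd_idem)
  have a: "?a \<in> A_state" using \<alpha> by (rule along_A_state)
  have "J t \<mu> ?a x ?a \<le> v (mf_flow t \<mu> ?a) t x + (\<epsilon> + 2 * \<delta>)" for x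
  proof -
    obtain i where i: "i \<in> {1..N}" "xs N i = x" using S0_surj[OF S0 N0] .
    have "J t \<mu> ?a x ?a - (\<epsilon> + 2 * \<delta>) \<le> J_flow (mf_flow t \<mu> ?a) t x b" if b: "b \<in> A_state" for b
    proof -
      \<comment> \<open>As \<open>?b\<close> ignores the measure, freezing it along the flow gives
        back \<open>b\<close>.\<close>
      let ?b = "\<lambda>s x _. b s x"
      have bL: "?b \<in> A_state_Lip L" using A_state_Lip_const[OF b L] .
      have "J_player N i t (xs N) (\<lambda>_. \<alpha>) \<le> J_player N i t (xs N) ((\<lambda>_. \<alpha>)(i := ?b)) + \<epsilon>"
        using opt[OF i(1)] v_N_le[OF bL, of N i t "xs N" \<alpha>] by linarith
      then show ?thesis
        using self[OF i(1)] close[rule_format, OF \<alpha> bL i(1)] i(2) by (simp add: J_def)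
    qed
    then have "J t \<mu> ?a x ?a - (\<epsilon> + 2 * \<delta>) \<le> v (mf_flow t \<mu> ?a) t x"
      unfolding v_def using a by (intro cINF_greatest) auto
    then show ?thesis by simp
  qed
  then have "?a \<in> M_state (\<epsilon> + 2 * \<delta>) t \<mu>" using a by (simp add: M_state_def)
  moreover have "\<bar>\<phi> x - J t \<mu> ?a x ?a\<bar> \<le> \<epsilon> + 2 * \<delta>" for x
  proof -
    obtain i where i: "i \<in> {1..N}" "xs N i = x" using S0_surj[OF S0 N0] .
    show ?thesis
      using self[OF i(1)] \<phi>J[of x] \<delta> unfolding J_player_eq_J_N[OF S0 i(1)] i(2) by linarith
  qed
  ultimately show "\<phi> \<in> V_state_eps (\<epsilon> + 2 * \<delta>) t \<mu>"
    by (auto simp: V_state_eps_def sup_norm_le_iff)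
qed

text \<open>The converse transfer: the mean field control is played as a feedback with constant 0,
  and each player deviation, frozen along the flow, becomes an admissible mean field
  deviation.\<close>

lemma eventually_V_state_eps_subset:
  assumes \<delta>: "0 < \<delta>"
  shows "\<forall>\<^sub>F N in sequentially. V_state_eps \<epsilon> t \<mu> \<subseteq> V_N N (\<epsilon> + 2 * \<delta>) 0 t (empirical N (xs N))"
  using eventually_J_player_close[OF order_refl \<delta>] eventually_ge_at_top[of "CARD('s)"]
proof (eventually_elim, intro subsetI)
  fix N \<phi>
  assume close: "\<forall>\<alpha>\<in>A_state_Lip 0. \<forall>\<alpha>'\<in>A_state_Lip 0. \<forall>i\<in>{1..N}.
      \<bar>J_player N i t (xs N) ((\<lambda>_. \<alpha>)(i := \<alpha>')) -
        J t \<mu> (along (feedback_flow t \<mu> \<alpha>) \<alpha>) (xs N i) (along (feedback_flow t \<mu> \<alpha>) \<alpha>')\<bar> \<le> \<delta>"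
    and N: "CARD('s) \<le> N" and \<phi>: "\<phi> \<in> V_state_eps \<epsilon> t \<mu>"
  have S0: "xs N \<in> S0 N" using N by (rule xs)
  have N0: "N > 0" using N by (metis zero_less_card_finite order_less_le_trans)
  obtain a where a: "a \<in> A_state"
    and opt: "\<And>x. J t \<mu> a x a \<le> v (mf_flow t \<mu> a) t x + \<epsilon>"
    and \<phi>J: "\<And>x. \<bar>\<phi> x - J t \<mu> a x a\<bar> \<le> \<epsilon>"
    using \<phi> by (auto simp: V_state_eps_def M_state_def sup_norm_le_iff)
  let ?\<alpha> = "\<lambda>s x _. a s x"
  have \<alpha>: "?\<alpha> \<in> A_state_Lip 0" using A_state_Lip_const[OF a] by simp
  have self: "\<bar>J_player N i t (xs N) (\<lambda>_. ?\<alpha>) - J t \<mu> a (xs N i) a\<bar> \<le> \<delta>" if "i \<in> {1..N}" for i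
    using close[rule_format, OF \<alpha> \<alpha> that] by (simp add: fun_upd_idem)
  have "J_player N i t (xs N) (\<lambda>_. ?\<alpha>) \<le> v_N N 0 i t (xs N) ?\<alpha> + (\<epsilon> + 2 * \<delta>)" if i: "i \<in> {1..N}" for i
  proof -
    have "J_player N i t (xs N) (\<lambda>_. ?\<alpha>) - (\<epsilon> + 2 * \<delta>) \<le> J_player N i t (xs N) ((\<lambda>_. ?\<alpha>)(i := \<alpha>'))"
      if \<alpha>': "\<alpha>' \<in> A_state_Lip 0" for \<alpha>'
    proof -
      let ?b = "along (feedback_flow t \<mu> ?\<alpha>) \<alpha>'"
      have "J t \<mu> a (xs N i) a \<le> J t \<mu> a (xs N i) ?b + \<epsilon>"
        using opt[of "xs N i"] v_le[OF along_A_state[OF \<alpha>'], of "mf_flow t \<mu> a" t "xs N i"]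
        unfolding J_def by (meson add_right_mono order_trans)
      then show ?thesis
        using self[OF i] close[rule_format, OF \<alpha> \<alpha>' i] unfolding along_const by linarith
    qed
    then have "J_player N i t (xs N) (\<lambda>_. ?\<alpha>) - (\<epsilon> + 2 * \<delta>) \<le> v_N N 0 i t (xs N) ?\<alpha>"
      unfolding v_N_def using \<alpha> by (intro cINF_greatest) auto
    then show ?thesis by simp
  qed
  then have "?\<alpha> \<in> M_N N (\<epsilon> + 2 * \<delta>) 0 t (empirical N (xs N))"
    using \<alpha> by (simp add: M_N_eq[OF S0] M_N_at_def)
  moreover have "\<bar>\<phi> x - J_N N t x (empirical N (xs N)) ?\<alpha>\<bar> \<le> \<epsilon> + 2 * \<delta>" for x
  proof -
    obtain i where i: "i \<in> {1..N}" "xs N i = x" using S0_surj[OF S0 N0] .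
    show ?thesis
      using self[OF i(1)] \<phi>J[of x] \<delta> unfolding J_player_eq_J_N[OF S0 i(1)] i(2) by linarith
  qed
  ultimately show "\<phi> \<in> V_N N (\<epsilon> + 2 * \<delta>) 0 t (empirical N (xs N))"
    by (auto simp: V_N_def sup_norm_le_iff)
qed

text \<open>\<open>L\<close> may depend on \<open>\<epsilon>\<close>, so it is extracted before the
  threshold in \<open>N\<close>. A single \<open>N\<close> beyond the threshold suffices, since the
  target set does not involve \<open>N\<close>.\<close>

lemma limsup_V_N_subset_V_state:
  "(\<Inter>\<epsilon>\<in>{0<..}. \<Union>L\<in>{0..}. set_limsup (\<lambda>N. V_N N \<epsilon> L t (empirical N (xs N)))) \<subseteq> V_state t \<mu>"
proof
  fix \<phi>
  assume \<phi>: "\<phi> \<in> (\<Inter>\<epsilon>\<in>{0<..}. \<Union>L\<in>{0..}. set_limsup (\<lambda>N. V_N N \<epsilon> L t (empirical N (xs N))))"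
  show "\<phi> \<in> V_state t \<mu>"
    unfolding V_state_def
  proof
    fix \<epsilon> :: real assume "\<epsilon> \<in> {0<..}"
    \<comment> \<open>One third for the equilibrium error and one for each use of closeness.\<close>
    then have e: "\<epsilon> / 3 > 0" by simp
    have "\<phi> \<in> (\<Union>L\<in>{0..}. set_limsup (\<lambda>N. V_N N (\<epsilon> / 3) L t (empirical N (xs N))))"
      using \<phi> e by blast
    then obtain L where L: "0 \<le> L" and lim: "\<phi> \<in> set_limsup (\<lambda>N. V_N N (\<epsilon> / 3) L t (empirical N (xs N)))"
      by auto
    obtain n where n: "\<And>N. n \<le> N \<Longrightarrow>
        V_N N (\<epsilon> / 3) L t (empirical N (xs N)) \<subseteq> V_state_eps (\<epsilon> / 3 + 2 * (\<epsilon> / 3)) t \<mu>"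
      using eventually_V_N_subset[OF L e] unfolding eventually_sequentially by blast
    have "\<phi> \<in> (\<Union>N\<in>{max 1 n..}. V_N N (\<epsilon> / 3) L t (empirical N (xs N)))"
      using lim unfolding set_limsup_def by (rule INT_D) simp
    then obtain N where "n \<le> N" "\<phi> \<in> V_N N (\<epsilon> / 3) L t (empirical N (xs N))"
      by auto
    with n[of N] show "\<phi> \<in> V_state_eps \<epsilon> t \<mu>" by auto
  qed
qed

text \<open>The inclusion holds for all \<open>N\<close> beyond one threshold, which is what a lower
  limit of sets demands.\<close>

lemma V_state_subset_liminf_V_N:
  "V_state t \<mu> \<subseteq> (\<Inter>\<epsilon>\<in>{0<..}. set_liminf (\<lambda>N. V_N N \<epsilon> 0 t (empirical N (xs N))))"
proof (intro subsetI INT_I)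
  fix \<phi> and \<epsilon> :: real assume \<phi>: "\<phi> \<in> V_state t \<mu>" and "\<epsilon> \<in> {0<..}"
  then have e: "\<epsilon> / 3 > 0" by simp
  obtain n where n: "\<And>N. n \<le> N \<Longrightarrow>
      V_state_eps (\<epsilon> / 3) t \<mu> \<subseteq> V_N N (\<epsilon> / 3 + 2 * (\<epsilon> / 3)) 0 t (empirical N (xs N))"
    using eventually_V_state_eps_subset[OF e] unfolding eventually_sequentially by blast
  have "\<phi> \<in> V_state_eps (\<epsilon> / 3) t \<mu>" using \<phi> e by (auto simp: V_state_def)
  then have "\<phi> \<in> V_N N \<epsilon> 0 t (empirical N (xs N))" if "n \<le> N" for N
    using n[OF that] by auto
  then show "\<phi> \<in> set_liminf (\<lambda>N. V_N N \<epsilon> 0 t (empirical N (xs N)))"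
    unfolding set_liminf_def by (intro UN_I[of "max 1 n"]) auto
qed

end

end

theorem theorem3p6:
  fixes T :: nat
    and A :: "'a::euclidean_space set"
    and q :: "nat \<Rightarrow> 's::finite \<Rightarrow> 's pmf \<Rightarrow> 'a \<Rightarrow> 's pmf"
    and F :: "nat \<Rightarrow> 's \<Rightarrow> 's pmf \<Rightarrow> 'a \<Rightarrow> real"
    and G :: "'s \<Rightarrow> 's pmf \<Rightarrow> real"
    and Lq C0 :: real
    and \<rho> :: "real \<Rightarrow> real"
    and t :: nat
    and xs :: "nat \<Rightarrow> nat \<Rightarrow> 's"
    and \<mu> :: "'s pmf"
  assumes game: "mean_field_game T A q F G"
    and q_Lipschitz: "\<And>s x y \<mu> \<nu> a b. s \<le> T \<Longrightarrow> a \<in> A \<Longrightarrow> b \<in> A \<Longrightarrow>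
      \<bar>pmf (q s x \<mu> a) y - pmf (q s x \<nu> b) y\<bar> \<le> Lq * (W1 \<mu> \<nu> + norm (a - b))"
    and F_bounded: "\<And>s x \<mu> a. s \<le> T \<Longrightarrow> a \<in> A \<Longrightarrow> \<bar>F s x \<mu> a\<bar> \<le> C0"
    and G_bounded: "\<And>x \<mu>. \<bar>G x \<mu>\<bar> \<le> C0"
    and \<rho>: "modulus_of_continuity \<rho>"
    and F_continuous: "\<And>s x \<mu> \<nu> a b. s \<le> T \<Longrightarrow> a \<in> A \<Longrightarrow> b \<in> A \<Longrightarrow>
      \<bar>F s x \<mu> a - F s x \<nu> b\<bar> \<le> \<rho> (W1 \<mu> \<nu> + norm (a - b))"
    and G_continuous: "\<And>x \<mu> \<nu>. \<bar>G x \<mu> - G x \<nu>\<bar> \<le> \<rho> (W1 \<mu> \<nu>)"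
    and t: "t \<le> T"
    and xs: "\<And>N. CARD('s) \<le> N \<Longrightarrow> xs N \<in> S0 N"
    and \<mu>: "\<mu> \<in> P0"
    and xs_lim: "(\<lambda>N. W1 (empirical N (xs N)) \<mu>) \<longlonglongrightarrow> 0"
  shows "(\<Inter>\<epsilon>\<in>{0<..}. \<Union>L\<in>{0..}. set_limsup (\<lambda>N. mean_field_game.V_N T A q F G N \<epsilon> L t (empirical N (xs N))))
      \<subseteq> mean_field_game.V_state T A q F G t \<mu>
    \<and> mean_field_game.V_state T A q F G t \<mu>
      \<subseteq> (\<Inter>\<epsilon>\<in>{0<..}. set_liminf (\<lambda>N. mean_field_game.V_N T A q F G N \<epsilon> 0 t (empirical N (xs N))))
    \<and> (\<forall>\<epsilon>>0. set_liminf (\<lambda>N. mean_field_game.V_N T A q F G N \<epsilon> 0 t (empirical N (xs N)))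
      \<subseteq> (\<Union>L\<in>{0..}. set_limsup (\<lambda>N. mean_field_game.V_N T A q F G N \<epsilon> L t (empirical N (xs N)))))
    \<and> (\<Inter>\<epsilon>\<in>{0<..}. \<Union>L\<in>{0..}. set_limsup (\<lambda>N. mean_field_game.V_N T A q F G N \<epsilon> L t (empirical N (xs N))))
      = mean_field_game.V_state T A q F G t \<mu>
    \<and> mean_field_game.V_state T A q F G t \<mu>
      = (\<Inter>\<epsilon>\<in>{0<..}. set_liminf (\<lambda>N. mean_field_game.V_N T A q F G N \<epsilon> 0 t (empirical N (xs N))))"
proof -
  interpret regular_mean_field_game T A q F G Lq C0 \<rho>
    using game by (rule regular_mean_field_game.intro) (unfold_locales; fact assms)
  note 1 = limsup_V_N_subset_V_state[OF t xs xs_lim]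
  note 2 = V_state_subset_liminf_V_N[OF t xs xs_lim]
  have 3: "set_liminf (\<lambda>N. V_N N \<epsilon> 0 t (empirical N (xs N)))
      \<subseteq> (\<Union>L\<in>{0..}. set_limsup (\<lambda>N. V_N N \<epsilon> L t (empirical N (xs N))))" for \<epsilon>
    using set_liminf_subset_set_limsup by fastforce
  \<comment> \<open>The three inclusions form a cycle once intersected over
    \<open>\<epsilon>\<close>, which yields both equalities.\<close>
  show ?thesis
    using 1 2 3 by (intro conjI allI impI subset_antisym) (blast+)
qed

end
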